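(* Let $p$ be an odd prime, $m$ a positive integer, $q=p^m$, $u$ a positive integer and $v=\gcd(m,u)$. Let $\mathrm{Tr}$ denote the trace map from $\mathbb{F}_q$ to $\mathbb{F}_p$. Let \[ D_2=\{(x,y)\in\mathbb{F}_q^2\setminus\{(0,0)\} : \mathrm{Tr}(x^2+y^{p^u+1})=0\}, \] and $C_{D_2}=\{c(a,b)=(\mathrm{Tr}(ax+by))_{(x,y)\in D_2} : a,b\in\mathbb{F}_q\}$. Suppose $\frac{m}{v}$ is odd or $\frac{m}{v}\equiv 2\pmod 4$. Then $C_{D_2}$ is an $[n,2m]$ two-weight linear code over $\mathbb{F}_p$, where \[ n=\begin{cases}(p^m+1)(p^{m-1}-1), & \text{if } p\equiv 3\pmod 4 \text{ and } v \text{ is odd},\\ (p^m-1)(p^{m-1}+1), & \text{otherwise},\end{cases} \] with the following weight distribution. If $p\equiv 3\pmod 4$ and $v$ is odd: weight $0$ with multiplicity $1$; weight $(p-1)p^{2m-2}$ with multiplicity $(p^m+1)(p^{m-1}-1)$; weight $(p-1)p^{2m-2}\left(1-\frac{1}{p^{m-1}}\right)$ with multiplicity $(p^m+1)p^{m-1}(p-1)$. Otherwise: weight $0$ with multiplicity $1$; weight $(p-1)p^{2m-2}$ with multiplicity $(p^m-1)(p^{m-1}+1)$; weight $(p-1)p^{2m-2}\left(1+\frac{1}{p^{m-1}}\right)$ with multiplicity $(p^m-1)p^{m-1}(p-1)$.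
   Context: An $[n,k]$ linear code over $\mathbb{F}_p$ is a $k$-dimensional subspace of $\mathbb{F}_p^n$. The multiplicity of a weight $w$ is the number of codewords of Hamming weight $w$; a code is $t$-weight if exactly $t$ nonzero weights occur.
   Formalization: The case m = 1 with p ≡ 3 (mod 4) is excluded: there D_2 is empty, since x^2+y^2=0 has only the trivial solution over F_p, so the code has length 0 and dimension 0 and the claimed [n,2m] two-weight code does not exist. *)

theory Defs
  imports Main "HOL-Computational_Algebra.Primes"
begin

text \<open>Trace map from F_q (q = p^m) to its prime field F_p, realised inside the field 'a.\<close>
definition tr :: "nat \<Rightarrow> nat \<Rightarrow> 'a::field \<Rightarrow> 'a" where
  "tr p m x = (\<Sum>i<m. x ^ (p ^ i))"

definition D2 :: "nat \<Rightarrow> nat \<Rightarrow> nat \<Rightarrow> ('a::field \<times> 'a) set" where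
  "D2 p m u = {(x, y). (x, y) \<noteq> (0, 0) \<and> tr p m (x ^ 2 + y ^ (p ^ u + 1)) = 0}"

definition cw :: "nat \<Rightarrow> nat \<Rightarrow> nat \<Rightarrow> 'a::field \<Rightarrow> 'a \<Rightarrow> ('a \<times> 'a \<Rightarrow> 'a)" where
  "cw p m u a b = (\<lambda>z. if z \<in> D2 p m u then tr p m (a * fst z + b * snd z) else 0)"

definition code :: "nat \<Rightarrow> nat \<Rightarrow> nat \<Rightarrow> ('a::field \<times> 'a \<Rightarrow> 'a) set" where
  "code p m u = {cw p m u a b | a b. True}"

definition hweight :: "'i set \<Rightarrow> ('i \<Rightarrow> 'a::zero) \<Rightarrow> nat" where
  "hweight S c = card {z \<in> S. c z \<noteq> 0}"

definition wmult :: "nat \<Rightarrow> nat \<Rightarrow> nat \<Rightarrow> nat \<Rightarrow> 'a::field itself \<Rightarrow> nat" where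
  "wmult p m u w _ = card {c \<in> (code p m u :: ('a \<times> 'a \<Rightarrow> 'a) set). hweight (D2 p m u) c = w}"

end

theory Submission
  imports Defs "HOL-Number_Theory.Residues" "HOL-Computational_Algebra.Polynomial"
    "HOL-Library.Product_Plus"
begin

text \<open>
  The form \<open>Q (x, y) = Tr (x\<^sup>2 + y ^ (p ^ u + 1))\<close> is a quadratic form of dimension \<open>2 m\<close> over the
  prime field, and the hypothesis on \<open>m / gcd m u\<close> says exactly that it is nondegenerate. Hence the
  codewords are the functions \<open>z \<mapsto> B z w\<close> on the nonzero isotropic vectors, where \<open>B\<close> is the polar
  form, and the weight of such a word depends only on whether \<open>Q w = 0\<close>. All that remains is the
  number of isotropic vectors, that is, the type of the form. If \<open>m / gcd m u\<close> is odd, then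
  \<open>y ^ (p ^ u + 1)\<close> is distributed like \<open>y\<^sup>2\<close>, and \<open>x\<^sup>2 + y\<^sup>2\<close> is hyperbolic or a norm form according
  to whether \<open>-1\<close> is a square. In the other case a second moment computation determines the number up
  to a sign, which is read off modulo \<open>p ^ gcd m u + 1\<close>.
\<close>

section \<open>Finite fields\<close>

text \<open>Everything rests on one integer, the difference X - Y of the numbers of solutions of
  \<open>Q z = 0\<close> and \<open>Q z = 1\<close>. Explicit similitudes show that the nonzero
  values of \<open>Q\<close> are equally frequent, so X + (p - 1) Y = p^(2m) and X - Y determines X.
  The hard case is m / v = 2 modulo 4 with v = gcd m u, where y^(p^u + 1) is no longer distributed
  like y^2. The sign left open by X - Y = p^m or -p^m is then found by comparison with the
  contribution of y = 0. That is the quadratic Gauss sum of Tr (x^2), which for even m is the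
  integer p^(m/2) or -p^(m/2). The pair m = 1, p = 3 modulo 4 is excluded because \<open>Q\<close>
  is then anisotropic: the code has no coordinates and no nonzero weight.\<close>

lemma power_card_UNIV_eq_self: "x ^ card (UNIV :: 'a set) = (x :: 'a::{finite,field})"
proof (cases "x = 0")
  case False
  have "x * (\<Prod>y\<in>UNIV-{0}. x * y) = x * x ^ (card (UNIV :: 'a set) - 1) * \<Prod>(UNIV-{0})"
    by (simp add: prod.distrib mult_ac)
  also have "x * x ^ (card (UNIV :: 'a set) - 1) = x ^ card (UNIV :: 'a set)"
    using finite_UNIV_card_ge_0[where ?'a = 'a] by (simp flip: power_Suc)
  also have "(\<Prod>y\<in>UNIV-{0}. x * y) = (\<Prod>y\<in>UNIV-{0}. y)"
    by (rule prod.reindex_bij_witness[of _ "\<lambda>y. y / x" "\<lambda>y. x * y"]) (use False in auto)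
  finally show ?thesis by simp
qed (use finite_UNIV_card_ge_0[where ?'a = 'a] in auto)

lemma power_card_UNIV_minus_1:
  assumes "x \<noteq> (0 :: 'a::{finite,field})"
  shows "x ^ (card (UNIV :: 'a set) - 1) = 1"
proof -
  have "x * x ^ (card (UNIV :: 'a set) - 1) = x * 1"
    using power_card_UNIV_eq_self[of x] finite_UNIV_card_ge_0[where ?'a = 'a]
    by (simp flip: power_Suc)
  then show ?thesis using assms by simp
qed

lemma card_nth_roots_le:
  assumes "k > 0"
  shows "card {t. t ^ k = (s :: 'a::field)} \<le> k"
proof -
  let ?f = "monom 1 k - [:s:]"
  have "coeff ?f k = 1" using assms by (cases k) simp_all
  then have "?f \<noteq> 0" by (metis coeff_0 zero_neq_one)
  from card_poly_roots_bound[OF this] have "card {t. t ^ k = s} \<le> degree ?f"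
    by (simp add: poly_monom)
  also have "\<dots> \<le> k" by (intro degree_diff_le degree_monom_le) simp
  finally show ?thesis .
qed

text \<open>With q - 1 = d k, the map t -> t^k sends the nonzero elements into the d-th roots of
  unity with fibres of size at most k, so there are at least d such roots. Cyclicity of the
  multiplicative group is not invoked.\<close>

lemma card_roots_of_unity_field:
  assumes "d dvd card (UNIV :: 'a::{finite,field} set) - 1"
  shows "card {t :: 'a. t ^ d = 1} = d"
proof -
  let ?q = "card (UNIV :: 'a set)"
  have q: "?q - 1 = card (UNIV - {0 :: 'a})" by (simp add: card_Diff_singleton)
  have "(1::'a) \<in> UNIV - {0}" by simp
  then have qpos: "?q - 1 > 0" unfolding q by (metis card_gt_0_iff empty_iff finite)
  obtain k where k: "?q - 1 = d * k" using assms by blast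
  have pos: "d > 0" "k > 0" using qpos k by (auto intro: gr0I)
  have "UNIV - {0 :: 'a} \<subseteq> (\<Union>s\<in>{s. s ^ d = 1}. {t. t ^ k = s})"
  proof
    fix t :: 'a assume "t \<in> UNIV - {0}"
    then have "t ^ (k * d) = 1"
      using power_card_UNIV_minus_1[of t] unfolding k by (simp add: mult.commute)
    then show "t \<in> (\<Union>s\<in>{s. s ^ d = 1}. {t. t ^ k = s})" by (simp add: power_mult)
  qed
  then have "d * k \<le> card (\<Union>s\<in>{s :: 'a. s ^ d = 1}. {t. t ^ k = s})"
    unfolding k[symmetric] q by (intro card_mono) auto
  also have "\<dots> \<le> (\<Sum>s\<in>{s :: 'a. s ^ d = 1}. card {t. t ^ k = s})"
    by (rule card_UN_le) simp
  also have "\<dots> \<le> (\<Sum>s\<in>{s :: 'a. s ^ d = 1}. k)"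
    by (intro sum_mono card_nth_roots_le pos)
  finally have "d \<le> card {s :: 'a. s ^ d = 1}" using pos by simp
  then show ?thesis using card_nth_roots_le[OF pos(1), of "1 :: 'a"] by simp
qed

lemma card_power_fibre:
  assumes "y \<noteq> (0 :: 'a::field)"
  shows "card {t \<in> UNIV - {0}. t ^ d = y ^ d} = card {t \<in> UNIV - {0 :: 'a}. t ^ d = 1}"
  by (rule bij_betw_same_card[of "\<lambda>t. t / y"], rule bij_betwI[of _ _ _ "\<lambda>t. t * y"])
     (use assms in \<open>auto simp: power_divide power_mult_distrib\<close>)

lemma sum_power_fibres:
  fixes h :: "'a::{finite,field} \<Rightarrow> int"
  shows "(\<Sum>y\<in>UNIV - {0}. h (y ^ d)) =
    int (card {t \<in> UNIV - {0 :: 'a}. t ^ d = 1}) * (\<Sum>s\<in>(\<lambda>y. y ^ d) ` (UNIV - {0}). h s)"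
proof -
  have "(\<Sum>y\<in>UNIV - {0}. h (y ^ d)) =
    (\<Sum>s\<in>(\<lambda>y. y ^ d) ` (UNIV - {0}). int (card {t \<in> UNIV - {0}. t ^ d = s}) * h s)"
    by (rule sum_fun_comp) auto
  also have "\<dots> = (\<Sum>s\<in>(\<lambda>y. y ^ d) ` (UNIV - {0}). int (card {t \<in> UNIV - {0 :: 'a}. t ^ d = 1}) * h s)"
  proof (intro sum.cong refl)
    fix s assume "s \<in> (\<lambda>y. y ^ d) ` (UNIV - {0 :: 'a})"
    then obtain y where "y \<noteq> 0" "s = y ^ d" by auto
    then show "int (card {t \<in> UNIV - {0}. t ^ d = s}) * h s =
      int (card {t \<in> UNIV - {0 :: 'a}. t ^ d = 1}) * h s"
      using card_power_fibre[of y d] by simp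
  qed
  finally show ?thesis by (simp add: sum_distrib_left)
qed

lemma card_power_image:
  "card (UNIV :: 'a::{finite,field} set) - 1 =
    card {t \<in> UNIV - {0 :: 'a}. t ^ d = 1} * card ((\<lambda>y. y ^ d) ` (UNIV - {0 :: 'a}))"
proof -
  have "int (card (UNIV - {0 :: 'a})) =
    int (card {t \<in> UNIV - {0 :: 'a}. t ^ d = 1}) * int (card ((\<lambda>y. y ^ d) ` (UNIV - {0 :: 'a})))"
    using sum_power_fibres[of "\<lambda>_. 1" d] by simp
  also have "card (UNIV - {0 :: 'a}) = card (UNIV :: 'a set) - 1"
    by (simp add: card_Diff_singleton)
  finally show ?thesis by (simp only: of_nat_eq_iff flip: of_nat_mult)
qed

text \<open>The image lies in the k-th roots of unity, and both sets have k elements.\<close>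

lemma power_image_eq_roots_of_unity:
  assumes "card (UNIV :: 'a::{finite,field} set) - 1 = d * k" "d > 0" "k > 0"
  shows "(\<lambda>y. y ^ d) ` (UNIV - {0 :: 'a}) = {s. s ^ k = 1}"
proof (rule card_subset_eq)
  have "card {t \<in> UNIV - {0 :: 'a}. t ^ d = 1} = card {t :: 'a. t ^ d = 1}"
    using assms(2) by (intro arg_cong[where f = card]) (auto simp: power_0_left)
  also have "\<dots> = d" by (rule card_roots_of_unity_field) (unfold assms(1), simp)
  finally have "d * k = d * card ((\<lambda>y. y ^ d) ` (UNIV - {0 :: 'a}))"
    using card_power_image[where ?'a = 'a, of d] unfolding assms(1) by simp
  moreover have "card {s :: 'a. s ^ k = 1} = k"
    by (rule card_roots_of_unity_field) (unfold assms(1), simp)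
  ultimately show "card ((\<lambda>y. y ^ d) ` (UNIV - {0 :: 'a})) = card {s :: 'a. s ^ k = 1}"
    using assms(2) by simp
  have "(y ^ d) ^ k = 1" if "y \<noteq> 0" for y :: 'a
    using power_card_UNIV_minus_1[OF that] unfolding assms(1) by (simp add: power_mult)
  then show "(\<lambda>y. y ^ d) ` (UNIV - {0 :: 'a}) \<subseteq> {s. s ^ k = 1}" by auto
qed simp

text \<open>Pigeonhole: there are more than \<open>q/2\<close> squares and as many elements \<open>c - b\<^sup>2\<close>.\<close>

lemma sum_of_two_squares_exists:
  assumes "odd (card (UNIV :: 'a::{finite,field} set))"
  shows "\<exists>a b. (c :: 'a) = a\<^sup>2 + b\<^sup>2"
proof (rule ccontr)
  assume neg: "\<not> ?thesis"
  let ?Sq = "range (\<lambda>a :: 'a. a\<^sup>2)" and ?T = "range (\<lambda>b :: 'a. c - b\<^sup>2)"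
  let ?q = "card (UNIV :: 'a set)"
  have "?Sq = insert 0 ((\<lambda>y. y\<^sup>2) ` (UNIV - {0 :: 'a}))" by auto
  then have *: "card ?Sq = Suc (card ((\<lambda>y. y\<^sup>2) ` (UNIV - {0 :: 'a})))"
    by (simp add: card_insert_if image_iff)
  have "?q - 1 \<le> 2 * card ((\<lambda>y. y\<^sup>2) ` (UNIV - {0 :: 'a}))"
  proof -
    have "card {t \<in> UNIV - {0 :: 'a}. t\<^sup>2 = 1} \<le> card {t :: 'a. t\<^sup>2 = 1}"
      by (intro card_mono) auto
    also have "\<dots> \<le> 2" by (rule card_nth_roots_le) simp
    finally show ?thesis
      unfolding card_power_image[where ?'a = 'a, of 2] by (rule mult_le_mono1)
  qed
  then have big: "?q < 2 * card ?Sq" using * by linarith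
  have T: "?T = (\<lambda>s. c - s) ` ?Sq" by auto
  have "card ?T = card ?Sq" unfolding T by (rule card_image) (auto intro: inj_onI)
  moreover have "?Sq \<inter> ?T = {}"
  proof (rule ccontr)
    assume "?Sq \<inter> ?T \<noteq> {}"
    then obtain a b where "a\<^sup>2 = c - b\<^sup>2" by auto
    then have "c = a\<^sup>2 + b\<^sup>2" by simp
    with neg show False by blast
  qed
  then have "card (?Sq \<union> ?T) = card ?Sq + card ?T" by (intro card_Un_disjoint) auto
  moreover have "card (?Sq \<union> ?T) \<le> ?q" by (intro card_mono) auto
  ultimately show False using big by linarith
qed

lemma minus_1_dvd_power_minus_1: "(b :: nat) - 1 dvd b ^ k - 1"
proof (induction k)
  case (Suc k)
  show ?case
  proof (cases "b = 0")
    case False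
    then have "b ^ Suc k - 1 = b * (b ^ k - 1) + (b - 1)"
      by (simp add: diff_mult_distrib2)
    then show ?thesis using Suc by (metis dvd_add dvd_mult dvd_refl)
  qed simp
qed simp

section \<open>Frobenius powers, their fixed fields and the trace\<close>

locale odd_prime_power_field =
  fixes p m :: nat and F :: "'a::{finite,field} itself"
  assumes prime_p: "prime p" and odd_p: "odd p" and m_pos: "m > 0"
    and card_UNIV: "card (UNIV :: 'a set) = p ^ m"
begin

abbreviation Tr :: "'a \<Rightarrow> 'a" where "Tr \<equiv> tr p m"

text \<open>For j dividing m this is the subfield with p^j elements, kept as a subset so that all
  subfields live in one type.\<close>

definition fixed :: "nat \<Rightarrow> 'a set" where "fixed j = {x. x ^ (p ^ j) = x}"

definition P :: "'a set" where "P = fixed 1"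

lemma p_ge3: "p \<ge> 3"
  using prime_ge_2_nat[OF prime_p] odd_p by (cases "p = 2") auto

lemma p_gt0 [simp]: "p > 0" and p_neq_0 [simp]: "p \<noteq> 0" using p_ge3 by simp_all

lemma CHAR_eq: "CHAR('a) = p"
proof -
  have "prime CHAR('a)" by (intro prime_CHAR_semidom finite_imp_CHAR_pos) simp
  moreover have "CHAR('a) dvd p ^ m" using CHAR_dvd_CARD[where ?'a = 'a] card_UNIV by simp
  ultimately have "CHAR('a) dvd p" by (rule prime_dvd_power)
  with \<open>prime CHAR('a)\<close> prime_p show ?thesis by (simp add: primes_dvd_imp_eq)
qed

lemma two_neq_0: "(2 :: 'a) \<noteq> 0"
proof
  assume "(2 :: 'a) = 0"
  then have "of_nat 2 = (0 :: 'a)" by simp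
  then have "p dvd 2" unfolding of_nat_eq_0_iff_char_dvd CHAR_eq .
  with p_ge3 show False by (auto dest: dvd_imp_le)
qed

lemma frob_add: "(x + y :: 'a) ^ (p ^ i) = x ^ (p ^ i) + y ^ (p ^ i)"
  by (rule freshmans_dream'[of _ i]) (simp_all add: CHAR_eq prime_p)

lemma frob_minus: "(- x :: 'a) ^ (p ^ i) = - (x ^ (p ^ i))"
  using odd_p by (intro power_minus_odd) simp

lemma frob_diff: "(x - y :: 'a) ^ (p ^ i) = x ^ (p ^ i) - y ^ (p ^ i)"
  using frob_add[of x "- y" i] by (simp add: frob_minus)

lemma frob_sum: "(sum f A :: 'a) ^ (p ^ i) = (\<Sum>j\<in>A. f j ^ (p ^ i))"
  by (rule freshmans_dream_sum'[of _ i]) (simp_all add: CHAR_eq prime_p)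

lemma frob_frob: "((x :: 'a) ^ (p ^ i)) ^ (p ^ j) = x ^ (p ^ (i + j))"
  by (simp add: power_add flip: power_mult)

lemma frob_m: "(x :: 'a) ^ (p ^ m) = x"
  using power_card_UNIV_eq_self[of x] by (simp add: card_UNIV)

lemma frob_mult_closed: "(x :: 'a) ^ (p ^ i) = x \<Longrightarrow> x ^ (p ^ (i * n)) = x"
  by (induction n) (simp_all flip: frob_frob)

lemma frob_dvd: "(x :: 'a) ^ (p ^ i) = x \<Longrightarrow> i dvd j \<Longrightarrow> x ^ (p ^ j) = x"
  by (auto simp: frob_mult_closed elim!: dvdE)

text \<open>Bezout on the exponents of Frobenius. With b = m it places the fixed points of the a-th
  Frobenius power in the subfield belonging to gcd a m.\<close>

lemma frob_gcd:
  assumes "(x :: 'a) ^ (p ^ a) = x" "x ^ (p ^ b) = x"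
  shows "x ^ (p ^ gcd a b) = x"
proof (cases "a = 0")
  case False
  then obtain s t where st: "a * s = b * t + gcd a b" using bezout_nat by blast
  have "x = x ^ (p ^ (b * t + gcd a b))"
    using frob_mult_closed[OF assms(1), of s] by (simp add: st)
  also have "\<dots> = x ^ (p ^ gcd a b)"
    using frob_mult_closed[OF assms(2), of t] by (simp flip: frob_frob)
  finally show ?thesis by simp
qed (use assms in simp)

lemma fixed_0 [simp]: "0 \<in> fixed j" and fixed_1 [simp]: "1 \<in> fixed j"
  by (auto simp: fixed_def power_0_left)

lemma fixed_add: "x \<in> fixed j \<Longrightarrow> y \<in> fixed j \<Longrightarrow> x + y \<in> fixed j"
  and fixed_diff: "x \<in> fixed j \<Longrightarrow> y \<in> fixed j \<Longrightarrow> x - y \<in> fixed j"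
  and fixed_minus: "x \<in> fixed j \<Longrightarrow> - x \<in> fixed j"
  and fixed_mult: "x \<in> fixed j \<Longrightarrow> y \<in> fixed j \<Longrightarrow> x * y \<in> fixed j"
  and fixed_divide: "x \<in> fixed j \<Longrightarrow> y \<in> fixed j \<Longrightarrow> x / y \<in> fixed j"
  by (auto simp: fixed_def frob_add frob_diff frob_minus power_mult_distrib power_divide)

lemma fixed_subset: "i dvd j \<Longrightarrow> fixed i \<subseteq> fixed j"
  by (auto simp: fixed_def intro: frob_dvd)

lemma fixed_m: "fixed m = UNIV" by (simp add: fixed_def frob_m)

lemmas P_closed = fixed_add[of _ 1, folded P_def] fixed_diff[of _ 1, folded P_def]
  fixed_minus[of _ 1, folded P_def] fixed_mult[of _ 1, folded P_def]
  fixed_divide[of _ 1, folded P_def]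

lemma P_0 [simp]: "0 \<in> P" and P_1 [simp]: "1 \<in> P" by (simp_all add: P_def)

lemma P_subset: "P \<subseteq> fixed j" unfolding P_def by (rule fixed_subset) simp

lemma P_frob: "c \<in> P \<Longrightarrow> c ^ (p ^ i) = c"
  unfolding P_def fixed_def using frob_dvd[of c 1] by simp

lemma fixed_eq_insert: "fixed j = insert 0 {t. t ^ (p ^ j - 1) = 1}"
proof -
  have "x ^ (p ^ j) = x * x ^ (p ^ j - 1)" for x :: 'a
    by (simp flip: power_Suc)
  then show ?thesis by (auto simp: fixed_def)
qed

lemma pj_gt_1: "j > 0 \<Longrightarrow> p ^ j > 1" using p_ge3 one_less_power[of p j] by linarith

lemma card_fixed:
  assumes "j dvd m" "j > 0"
  shows "card (fixed j) = p ^ j"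
proof -
  have "p ^ j - 1 dvd card (UNIV :: 'a set) - 1"
    using assms(1) minus_1_dvd_power_minus_1[of "p ^ j"] by (auto simp: card_UNIV power_mult elim!: dvdE)
  then have "card {t :: 'a. t ^ (p ^ j - 1) = 1} = p ^ j - 1"
    by (rule card_roots_of_unity_field)
  then show ?thesis
    using pj_gt_1[OF assms(2)] by (simp add: fixed_eq_insert card_insert_if power_0_left)
qed

lemma card_P: "card P = p" unfolding P_def using card_fixed[of 1] by simp

text \<open>Connects the Frobenius-fixed elements with the form in which the theorem states the
  values of codewords.\<close>

lemma P_eq: "P = {of_nat k | k. k < p}"
proof -
  have "of_nat k ^ p = (of_nat k :: 'a)" for k
    by (induction k) (use frob_add[of _ _ 1] in \<open>simp_all add: power_0_left\<close>)
  then have "of_nat ` {..<p} \<subseteq> P" by (auto simp: P_def fixed_def)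
  moreover have "inj_on (of_nat :: nat \<Rightarrow> 'a) {..<p}"
  proof (rule linorder_inj_onI')
    fix i j :: nat assume "i \<in> {..<p}" "j \<in> {..<p}" "i < j"
    then have "\<not> p dvd j - i" by (auto dest: dvd_imp_le)
    moreover have "of_nat j - of_nat i = (of_nat (j - i) :: 'a)" using \<open>i < j\<close> by simp
    ultimately show "(of_nat i :: 'a) \<noteq> of_nat j"
      by (metis CHAR_eq cancel_comm_monoid_add_class.diff_cancel of_nat_eq_0_iff_char_dvd)
  qed
  then have "card ((of_nat :: nat \<Rightarrow> 'a) ` {..<p}) = card P"
    by (simp add: card_image card_P)
  ultimately have "of_nat ` {..<p} = P" by (intro card_subset_eq) auto
  then show ?thesis by auto
qed

lemma tr_0 [simp]: "tr p j (0 :: 'a) = 0"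
  by (simp add: tr_def power_0_left)

lemma tr_add: "tr p j (x + y :: 'a) = tr p j x + tr p j y"
  by (simp add: tr_def frob_add sum.distrib)

lemma tr_diff: "tr p j (x - y :: 'a) = tr p j x - tr p j y"
  by (simp add: tr_def frob_diff sum_subtractf)

lemma tr_scale: "c \<in> P \<Longrightarrow> tr p j (c * x :: 'a) = c * tr p j x"
  by (simp add: tr_def power_mult_distrib P_frob sum_distrib_left)

lemma Tr_frob1: "Tr (x ^ p) = Tr x"
proof -
  obtain k where k: "m = Suc k" using m_pos by (cases m) auto
  have "Tr (x ^ p) = (\<Sum>i<Suc k. x ^ (p ^ Suc i))"
    by (simp add: tr_def k flip: power_mult)
  also have "\<dots> = (\<Sum>i<k. x ^ (p ^ Suc i)) + x" using frob_m[of x] by (simp add: k)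
  also have "\<dots> = Tr x" by (simp add: tr_def k sum.lessThan_Suc_shift del: sum.lessThan_Suc)
  finally show ?thesis .
qed

lemma Tr_frob: "Tr (x ^ (p ^ i)) = Tr x"
proof (induction i)
  case (Suc i)
  have "x ^ (p ^ Suc i) = (x ^ (p ^ i)) ^ p" by (simp add: mult.commute flip: power_mult)
  then show ?case using Suc by (simp add: Tr_frob1)
qed simp

lemma Tr_in_P: "Tr x \<in> P"
proof -
  have "Tr x ^ p ^ 1 = (\<Sum>i<m. (x ^ (p ^ i)) ^ (p ^ 1))"
    unfolding tr_def by (rule frob_sum)
  also have "\<dots> = Tr (x ^ (p ^ 1))" by (simp add: tr_def mult.commute flip: power_mult)
  finally show ?thesis by (simp add: P_def fixed_def Tr_frob1)
qed

text \<open>As a polynomial the trace is nonzero of degree at most p^(j-1), too small to vanish on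
  p^j elements.\<close>

lemma tr_nonzero:
  assumes "j dvd m" "j > 0"
  shows "\<exists>y\<in>fixed j. tr p j y \<noteq> (0 :: 'a)"
proof (rule ccontr)
  assume neg: "\<not> ?thesis"
  let ?f = "\<Sum>i<j. monom (1 :: 'a) (p ^ i)"
  have "coeff ?f 1 = (\<Sum>i<j. if i = 0 then 1 else 0)"
    unfolding coeff_sum using p_ge3 by (intro sum.cong refl) auto
  also have "\<dots> = 1" using assms by (simp add: sum.delta)
  finally have "?f \<noteq> 0" by auto
  moreover have "degree ?f \<le> p ^ (j - 1)"
    using p_ge3 by (intro degree_sum_le) (auto intro!: order.trans[OF degree_monom_le] power_increasing)
  ultimately have "card {x. poly ?f x = 0} \<le> p ^ (j - 1)"
    using card_poly_roots_bound le_trans by blast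
  moreover have "fixed j \<subseteq> {x. poly ?f x = 0}"
    using neg by (auto simp: poly_sum poly_monom tr_def)
  then have "p ^ j \<le> card {x. poly ?f x = 0}"
    using card_fixed[OF assms] by (metis card_mono finite)
  moreover have "p ^ (j - 1) < p ^ j" using assms p_ge3 by (intro power_strict_increasing) auto
  ultimately show False by linarith
qed

lemma Tr_nondegenerate:
  assumes "\<And>x. Tr (a * x) = 0"
  shows "a = 0"
proof (rule ccontr)
  assume "a \<noteq> 0"
  obtain y where "Tr y \<noteq> 0" using tr_nonzero[of m] m_pos by auto
  with assms[of "y / a"] \<open>a \<noteq> 0\<close> show False by simp
qed

end

section \<open>Quadratic forms over finite fields\<close>

lemma card_eq_sum_fibres:
  assumes "finite A" "finite C" "\<And>z. z \<in> A \<Longrightarrow> g z \<in> C"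
  shows "card A = (\<Sum>c\<in>C. card {z \<in> A. g z = c})"
proof -
  have "(\<Sum>z\<in>A. 1 :: nat) = (\<Sum>c\<in>C. of_nat (card {z \<in> A. g z = c}) * 1)"
    using assms by (intro sum_fun_comp) auto
  then show ?thesis by simp
qed

text \<open>The whole field acts on the vectors, but \<open>Q\<close> and \<open>B\<close> are
  homogeneous only over the subfield \<open>K\<close>: in the application \<open>K\<close> is the
  prime field and the vectors are pairs over the large field. \<open>B\<close> is the polar form
  without the factor 1/2, so \<open>B w w = 2 * Q w\<close>.\<close>

locale quadratic_form = vector_space scale
  for scale :: "'a::field \<Rightarrow> 'v::{finite,ab_group_add} \<Rightarrow> 'v" (infixr "*s" 75) +
  fixes K :: "'a set" and Q :: "'v \<Rightarrow> 'a" and B :: "'v \<Rightarrow> 'v \<Rightarrow> 'a"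
  assumes finite_K: "finite K" and K_0: "0 \<in> K" and K_1: "1 \<in> K"
    and K_add: "\<And>a b. a \<in> K \<Longrightarrow> b \<in> K \<Longrightarrow> a + b \<in> K"
    and K_diff: "\<And>a b. a \<in> K \<Longrightarrow> b \<in> K \<Longrightarrow> a - b \<in> K"
    and K_mult: "\<And>a b. a \<in> K \<Longrightarrow> b \<in> K \<Longrightarrow> a * b \<in> K"
    and K_divide: "\<And>a b. a \<in> K \<Longrightarrow> b \<in> K \<Longrightarrow> a / b \<in> K"
    and two_neq_0: "(2 :: 'a) \<noteq> 0"
    and Q_in_K: "\<And>z. Q z \<in> K"
    and Q_add: "\<And>z w. Q (z + w) = Q z + Q w + B z w"
    and Q_scale: "\<And>a z. a \<in> K \<Longrightarrow> Q (a *s z) = a\<^sup>2 * Q z"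
    and B_add_left: "\<And>z z' w. B (z + z') w = B z w + B z' w"
    and B_scale_left: "\<And>a z w. a \<in> K \<Longrightarrow> B (a *s z) w = a * B z w"
    and nondegenerate: "\<And>w. (\<And>z. B z w = 0) \<Longrightarrow> w = 0"
begin

lemma B_sym: "B z w = B w z"
proof -
  have "Q z + Q w + B z w = Q w + Q z + B w z"
    unfolding Q_add[symmetric] by (simp only: add.commute)
  then show ?thesis by simp
qed

lemma B_add_right: "B z (w + w') = B z w + B z w'"
  by (simp add: B_sym[of z] B_add_left)

lemma B_scale_right: "a \<in> K \<Longrightarrow> B z (a *s w) = a * B z w"
  by (simp add: B_sym[of z] B_scale_left)

lemma B_diff_left: "B (z - z') w = B z w - B z' w"
  using B_add_left[of "z - z'" z' w] by simp

lemma B_diff_right: "B z (w - w') = B z w - B z w'"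
  by (simp add: B_sym[of z] B_diff_left)

lemma Q_0 [simp]: "Q 0 = 0" using Q_scale[OF K_0, of 0] by simp

lemma B_0_left [simp]: "B 0 w = 0" using B_diff_left[of 0 0 w] by simp

lemma B_0_right [simp]: "B z 0 = 0" using B_sym[of z 0] by simp

lemma B_in_K: "B z w \<in> K"
proof -
  have "B z w = Q (z + w) - Q z - Q w" by (simp add: Q_add)
  then show ?thesis by (simp add: K_diff Q_in_K)
qed

lemma K_2: "2 \<in> K" using K_add[OF K_1 K_1] by simp

lemma B_self: "B w w = 2 * Q w"
proof -
  have "w + w = (1 + 1) *s w" by (simp only: scale_left_distrib scale_one)
  then have "w + w = 2 *s w" by simp
  then have "Q (w + w) = 2\<^sup>2 * Q w" using Q_scale[OF K_2] by simp
  then show ?thesis by (simp add: Q_add algebra_simps)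
qed

lemma Q_line: "t \<in> K \<Longrightarrow> Q (z + t *s w) = Q z + t * B z w + t\<^sup>2 * Q w"
  by (simp add: Q_add Q_scale B_scale_right)

lemma Q_line_diff: "t \<in> K \<Longrightarrow> Q (z - t *s w) = Q z - t * B z w + t\<^sup>2 * Q w"
  using Q_line[of "- t" z w] K_diff[OF K_0, of t] by simp

text \<open>Translations along a vector \<open>z1\<close> with \<open>B z1 w = 1\<close> permute the
  fibres transitively.\<close>

lemma card_B_fibre:
  assumes "w \<noteq> 0" "c \<in> K"
  shows "card K * card {z. B z w = c} = card (UNIV :: 'v set)"
proof -
  obtain z0 where z0: "B z0 w \<noteq> 0" using nondegenerate[of w] assms by blast
  define z1 where "z1 = (1 / B z0 w) *s z0"
  have z1: "B z1 w = 1" using z0 by (simp add: z1_def B_scale_left K_divide K_1 B_in_K)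
  have eq: "card {z. B z w = d} = card {z. B z w = c}" if "d \<in> K" for d
    by (rule bij_betw_same_card[of "\<lambda>z. z + (c - d) *s z1"],
        rule bij_betwI[of _ _ _ "\<lambda>z. z - (c - d) *s z1"])
       (use that assms in \<open>auto simp: B_add_left B_diff_left B_scale_left K_diff z1\<close>)
  have "card (UNIV :: 'v set) = (\<Sum>d\<in>K. card {z \<in> UNIV. B z w = d})"
    by (rule card_eq_sum_fibres) (auto simp: finite_K B_in_K)
  also have "\<dots> = (\<Sum>d\<in>K. card {z. B z w = c})" by (intro sum.cong) (auto simp: eq)
  finally show ?thesis by simp
qed

lemma card_B_nonzero:
  assumes "w \<noteq> 0"
  shows "card K * card {z. B z w \<noteq> 0} = (card K - 1) * card (UNIV :: 'v set)"
proof -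
  have "card (UNIV :: 'v set) = card {z. B z w = 0} + card {z. B z w \<noteq> 0}"
    by (subst card_Un_disjoint[symmetric]) (auto intro: arg_cong[where f = card])
  then have "card K * card (UNIV :: 'v set) = card K * card {z. B z w = 0} + card K * card {z. B z w \<noteq> 0}"
    by (metis add_mult_distrib2)
  with card_B_fibre[OF assms K_0] show ?thesis by (simp add: diff_mult_distrib)
qed

text \<open>Along a line in the direction of an isotropic \<open>w\<close>, the form is affine; off the hyperplane
  orthogonal to \<open>w\<close> it therefore takes every value exactly once.\<close>

lemma card_isotropic_off_hyperplane:
  assumes "w \<noteq> 0" "Q w = 0"
  shows "card K ^ 2 * card {z. Q z = 0 \<and> B z w \<noteq> 0} = (card K - 1) * card (UNIV :: 'v set)"
proof -
  have Bw: "B w w = 0" by (simp add: B_self assms)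
  have "bij_betw (\<lambda>(z, t). z + t *s w) ({z. Q z = 0 \<and> B z w \<noteq> 0} \<times> K) {z. B z w \<noteq> 0}"
    by (rule bij_betwI[of _ _ _ "\<lambda>z. (z - (Q z / B z w) *s w, Q z / B z w)"])
       (auto simp: B_add_left B_diff_left B_scale_left Q_line Q_line_diff assms Bw
          K_divide Q_in_K B_in_K)
  then have "card {z. Q z = 0 \<and> B z w \<noteq> 0} * card K = card {z. B z w \<noteq> 0}"
    using bij_betw_same_card by (fastforce simp: card_cartesian_product)
  then show ?thesis
    using card_B_nonzero[OF assms(1)] by (simp add: power2_eq_square mult_ac)
qed

section \<open>Counting when all nonzero values are equally frequent\<close>

context
  assumes level_sets: "\<And>c. c \<in> K \<Longrightarrow> c \<noteq> 0 \<Longrightarrow> card {z. Q z = c} = card {z. Q z = 1}"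
begin

lemma sum_over_levels:
  fixes f :: "nat \<Rightarrow> nat"
  shows "(\<Sum>c\<in>K. f (card {z. Q z = c})) =
    f (card {z. Q z = 0}) + (card K - 1) * f (card {z. Q z = 1})"
proof -
  have "(\<Sum>c\<in>K. f (card {z. Q z = c})) =
    f (card {z. Q z = 0}) + (\<Sum>c\<in>K - {0}. f (card {z. Q z = c}))"
    by (simp add: sum.remove[OF finite_K K_0])
  also have "(\<Sum>c\<in>K - {0}. f (card {z. Q z = c})) = (\<Sum>c\<in>K - {0}. f (card {z. Q z = 1}))"
    by (intro sum.cong refl) (use level_sets in auto)
  finally show ?thesis by (simp add: K_0 finite_K)
qed

lemma card_eq_levels:
  "card (UNIV :: 'v set) = card {z. Q z = 0} + (card K - 1) * card {z. Q z = 1}"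
  using card_eq_sum_fibres[of UNIV K Q] sum_over_levels[of "\<lambda>x. x"] by (simp add: finite_K Q_in_K)

text \<open>For anisotropic \<open>w\<close> the previous argument applies to the form \<open>Q z - s\<^sup>2 Q w\<close> in one more
  variable \<open>s\<close>, for which the vector \<open>(w, 1)\<close> is isotropic.\<close>

lemma card_isotropic_on_hyperplane:
  assumes "Q w \<noteq> 0"
  shows "card K ^ 2 * card {z. Q z = 0 \<and> B z w = 0} = card (UNIV :: 'v set)"
proof -
  define c where "c = Q w"
  have c: "c \<noteq> 0" "c \<in> K" "2 * c \<noteq> 0" "2 * c \<in> K"
    using assms two_neq_0 by (auto simp: c_def Q_in_K K_mult K_2)
  have Bw: "B w w = 2 * c" by (simp add: B_self c_def)
  let ?N = "card (UNIV :: 'v set)"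
  let ?E = "{(z, s). s \<in> K \<and> Q z = s\<^sup>2 * c}"
  let ?E1 = "{(z, s). s \<in> K \<and> Q z = s\<^sup>2 * c \<and> B z w = s * (2 * c)}"
  let ?E2 = "{(z, s). s \<in> K \<and> Q z = s\<^sup>2 * c \<and> B z w \<noteq> s * (2 * c)}"
  let ?G = "{(z, s). s \<in> K \<and> B z w \<noteq> s * (2 * c)}"
  let ?G' = "{(z, s). s \<in> K \<and> B z w = s * (2 * c)}"
  let ?H = "{z. Q z = 0 \<and> B z w = 0}"
  have fin: "finite ((UNIV :: 'v set) \<times> K)" by (simp add: finite_K)
  have finE: "finite ?E" by (rule finite_subset[OF _ fin]) auto
  \<comment> \<open>Each nonzero s contributes the level of \<open>s\<^sup>2 * c\<close>. These
    values fill only one square class, but by equidistribution the total is the same as over all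
    levels.\<close>
  have E: "card ?E = ?N"
  proof -
    have "card ?E = (\<Sum>s\<in>K. card {x \<in> ?E. snd x = s})"
      by (rule card_eq_sum_fibres) (use finE finite_K in auto)
    also have "\<dots> = (\<Sum>s\<in>K. card {z. Q z = s\<^sup>2 * c})"
    proof (intro sum.cong refl)
      fix s assume "s \<in> K"
      then have "{x \<in> ?E. snd x = s} = (\<lambda>z. (z, s)) ` {z. Q z = s\<^sup>2 * c}" by auto
      then show "card {x \<in> ?E. snd x = s} = card {z. Q z = s\<^sup>2 * c}"
        by (simp add: card_image inj_on_def)
    qed
    also have "\<dots> = card {z. Q z = 0} + (\<Sum>s\<in>K - {0}. card {z. Q z = s\<^sup>2 * c})"
      by (simp add: sum.remove[OF finite_K K_0])
    also have "(\<Sum>s\<in>K - {0}. card {z. Q z = s\<^sup>2 * c}) = (\<Sum>s\<in>K - {0}. card {z. Q z = 1})"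
      by (intro sum.cong refl level_sets) (use c in \<open>auto simp: K_mult power2_eq_square\<close>)
    finally show ?thesis using card_eq_levels by (simp add: K_0 finite_K)
  qed
  have "?G' = (\<lambda>z. (z, B z w / (2 * c))) ` UNIV"
    using c by (auto simp: K_divide B_in_K)
  then have G': "card ?G' = ?N" by (simp add: card_image inj_on_def)
  have "card ((UNIV :: 'v set) \<times> K) = card (?G \<union> ?G')"
    by (rule arg_cong[where f = card]) auto
  also have "\<dots> = card ?G + card ?G'"
    by (rule card_Un_disjoint) (auto intro: finite_subset[OF _ fin])
  finally have G: "?N * card K = card ?G + ?N" using G' by (simp add: card_cartesian_product)
  \<comment> \<open>The extended form Q z - s^2 c is affine in t along (z, s) - t (w, 1), and T z s
    is its zero.\<close>
  define T where "T z s = (Q z - s\<^sup>2 * c) / (B z w - s * (2 * c))" for z s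
  have T_K: "T z s \<in> K" if "s \<in> K" for z s
    using that c by (simp add: T_def K_divide K_diff K_mult Q_in_K B_in_K power2_eq_square)
  have num: "Q (z + t *s w) - (s + t)\<^sup>2 * c = Q z - s\<^sup>2 * c + t * (B z w - s * (2 * c))"
    if "t \<in> K" for z s t
    using that by (simp add: Q_line c_def[symmetric] power2_eq_square algebra_simps)
  have den: "B (z + t *s w) w - (s + t) * (2 * c) = B z w - s * (2 * c)" if "t \<in> K" for z s t
    using that by (simp add: B_add_left B_scale_left Bw algebra_simps)
  have num': "Q (z - t *s w) - (s - t)\<^sup>2 * c = Q z - s\<^sup>2 * c - t * (B z w - s * (2 * c))"
    if "t \<in> K" for z s t
    using that by (simp add: Q_line_diff c_def[symmetric] power2_eq_square algebra_simps)
  have den': "B (z - t *s w) w - (s - t) * (2 * c) = B z w - s * (2 * c)" if "t \<in> K" for z s t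
    using that by (simp add: B_diff_left B_scale_left Bw algebra_simps)
  have "bij_betw (\<lambda>((z, s), t). (z + t *s w, s + t)) (?E2 \<times> K) ?G"
  proof (rule bij_betwI[of _ _ _ "\<lambda>(z, s). ((z - T z s *s w, s - T z s), T z s)"])
    show "(\<lambda>((z, s), t). (z + t *s w, s + t)) \<in> ?E2 \<times> K \<rightarrow> ?G"
    proof -
      have "B (z + t *s w) w = (s + t) * (2 * c) \<longleftrightarrow> B z w = s * (2 * c)" if "t \<in> K" for z s t
        using den[OF that, of z s] by (metis right_minus_eq)
      then show ?thesis by (auto simp: K_add)
    qed
    show "(\<lambda>(z, s). ((z - T z s *s w, s - T z s), T z s)) \<in> ?G \<rightarrow> ?E2 \<times> K"
    proof (clarsimp simp: T_K K_diff)
      fix z s assume s: "s \<in> K" and ne: "B z w \<noteq> s * (2 * c)"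
      have "T z s * (B z w - s * (2 * c)) = Q z - s\<^sup>2 * c" using ne by (simp add: T_def)
      then have "Q (z - T z s *s w) - (s - T z s)\<^sup>2 * c = 0"
        using num'[OF T_K[OF s]] by simp
      moreover have "B (z - T z s *s w) w - (s - T z s) * (2 * c) \<noteq> 0"
        using ne by (simp add: den'[OF T_K[OF s]])
      ultimately show "Q (z - T z s *s w) = (s - T z s)\<^sup>2 * c \<and>
        B (z - T z s *s w) w \<noteq> (s - T z s) * (2 * c)" by simp
    qed
    have "T (z + t *s w) (s + t) = t"
      if "t \<in> K" "Q z = s\<^sup>2 * c" "B z w \<noteq> s * (2 * c)" for z s t
      using that by (simp only: T_def num den) simp
    then show "(\<lambda>(z, s). ((z - T z s *s w, s - T z s), T z s))
        ((\<lambda>((z, s), t). (z + t *s w, s + t)) x) = x" if "x \<in> ?E2 \<times> K" for x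
      using that by auto
  qed auto
  then have E2: "card ?E2 * card K = card ?G"
    using bij_betw_same_card by (fastforce simp: card_cartesian_product)
  \<comment> \<open>The isotropic vectors of the extended form orthogonal to (w, 1) are (z, 0) + s
    (w, 1) with z in \<open>?H\<close>.\<close>
  have "bij_betw (\<lambda>(z, s). (z + s *s w, s)) (?H \<times> K) ?E1"
    by (rule bij_betwI[of _ _ _ "\<lambda>(z, s). (z - s *s w, s)"])
       (auto simp: B_add_left B_diff_left B_scale_left Q_line Q_line_diff Bw
          power2_eq_square c_def[symmetric])
  then have E1: "card ?H * card K = card ?E1"
    using bij_betw_same_card by (fastforce simp: card_cartesian_product)
  have "card ?E = card (?E1 \<union> ?E2)" by (rule arg_cong[where f = card]) auto
  also have "\<dots> = card ?E1 + card ?E2"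
    by (rule card_Un_disjoint) (auto intro: finite_subset[OF _ fin])
  finally have "?N = card ?H * card K + card ?E2" using E E1 by simp
  then have "?N * card K = card ?H * card K * card K + card ?E2 * card K"
    by (simp add: add_mult_distrib)
  then show ?thesis using E2 G by (simp add: power2_eq_square mult_ac)
qed

text \<open>The substitution \<open>z = a + b\<close>, \<open>z' = a - b\<close> turns \<open>Q z = Q z'\<close> into \<open>B a b = 0\<close>.\<close>

lemma card_level_difference_squared:
  assumes "card K > 1"
  shows "(int (card {z. Q z = 0}) - int (card {z. Q z = 1}))\<^sup>2 = int (card (UNIV :: 'v set))"
proof -
  let ?N = "card (UNIV :: 'v set)"
  let ?X = "card {z. Q z = 0}" and ?Y = "card {z. Q z = 1}"
  let ?M = "{(z, z'). Q z = Q z'}" and ?O = "{(a, b). B a b = 0}"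
  have half: "1 / 2 \<in> K" by (simp add: K_divide K_1 K_2)
  have halves: "(1 / 2) *s (z + z') + (1 / 2) *s (z - z') = z"
     "(1 / 2) *s (z + z') - (1 / 2) *s (z - z') = z'" for z z'
  proof -
    have "(1 / 2) *s z + (1 / 2) *s z = z" for z
    proof -
      have "(1 / 2) + (1 / 2) = (1 :: 'a)" using two_neq_0 by (simp flip: mult_2)
      then show ?thesis using scale_left_distrib[of "1 / 2" "1 / 2" z] by simp
    qed
    note half_add = this
    have "(1 / 2) *s (z + z') + (1 / 2) *s (z - z') = (1 / 2) *s z + (1 / 2) *s z"
      "(1 / 2) *s (z + z') - (1 / 2) *s (z - z') = (1 / 2) *s z' + (1 / 2) *s z'"
      by (simp_all add: scale_right_distrib scale_right_diff_distrib)
    then show "(1 / 2) *s (z + z') + (1 / 2) *s (z - z') = z"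
      "(1 / 2) *s (z + z') - (1 / 2) *s (z - z') = z'"
      by (simp_all only: half_add)
  qed
  have doubles: "(1 / 2) *s (x + x) = x" for x
    using halves(1)[of x x] by (simp add: scale_right_distrib)
  have "bij_betw (\<lambda>(a, b). (a + b, a - b)) ?O ?M"
  proof (rule bij_betwI[of _ _ _ "\<lambda>(z, z'). ((1 / 2) *s (z + z'), (1 / 2) *s (z - z'))"])
    have "Q (a - b) = Q a + Q b - B a b" for a b
      using Q_line_diff[OF K_1, of a b] by simp
    then show "(\<lambda>(a, b). (a + b, a - b)) \<in> ?O \<rightarrow> ?M" by (auto simp: Q_add)
    have "B (z + z') (z - z') = 2 * (Q z - Q z')" for z z'
      using B_sym[of z' z] by (simp add: B_add_left B_diff_right B_self right_diff_distrib)
    then show "(\<lambda>(z, z'). ((1 / 2) *s (z + z'), (1 / 2) *s (z - z'))) \<in> ?M \<rightarrow> ?O"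
      by (auto simp: B_scale_left B_scale_right half)
    have "(a + b) + (a - b) = a + a" "(a + b) - (a - b) = b + b" for a b :: 'v by simp_all
    then show "(\<lambda>(z, z'). ((1 / 2) *s (z + z'), (1 / 2) *s (z - z')))
        ((\<lambda>(a, b). (a + b, a - b)) x) = x" for x
      by (cases x) (simp only: case_prod_conv doubles)
    show "(\<lambda>(a, b). (a + b, a - b))
        ((\<lambda>(z, z'). ((1 / 2) *s (z + z'), (1 / 2) *s (z - z'))) y) = y" for y
      by (cases y) (simp only: case_prod_conv halves)
  qed
  then have MO: "card ?M = card ?O" by (rule bij_betw_same_card[symmetric])
  have "card ?M = (\<Sum>c\<in>K. card {x \<in> ?M. Q (fst x) = c})"
    by (rule card_eq_sum_fibres) (auto simp: finite_K Q_in_K)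
  also have "\<dots> = (\<Sum>c\<in>K. (card {z. Q z = c})\<^sup>2)"
  proof (intro sum.cong refl)
    fix c
    have "{x \<in> ?M. Q (fst x) = c} = {z. Q z = c} \<times> {z. Q z = c}" by auto
    then show "card {x \<in> ?M. Q (fst x) = c} = (card {z. Q z = c})\<^sup>2"
      by (simp add: card_cartesian_product power2_eq_square)
  qed
  also have "\<dots> = ?X\<^sup>2 + (card K - 1) * ?Y\<^sup>2" by (rule sum_over_levels)
  finally have M: "card ?M = ?X\<^sup>2 + (card K - 1) * ?Y\<^sup>2" .
  have "card ?O = (\<Sum>b\<in>UNIV. card {x \<in> ?O. snd x = b})"
    by (rule card_eq_sum_fibres) auto
  also have "\<dots> = (\<Sum>b\<in>UNIV. card {a. B a b = 0})"
  proof (intro sum.cong refl)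
    fix b
    have "{x \<in> ?O. snd x = b} = (\<lambda>a. (a, b)) ` {a. B a b = 0}" by auto
    then show "card {x \<in> ?O. snd x = b} = card {a. B a b = 0}"
      by (simp add: card_image inj_on_def)
  qed
  also have "\<dots> = card {a. B a 0 = 0} + (\<Sum>b\<in>UNIV - {0}. card {a. B a b = 0})"
    by (rule sum.remove) auto
  finally have "card K * card ?O = card K * ?N + (\<Sum>b\<in>UNIV - {0 :: 'v}. card K * card {a. B a b = 0})"
    by (simp add: add_mult_distrib2 sum_distrib_left)
  also have "(\<Sum>b\<in>UNIV - {0}. card K * card {a. B a b = 0}) = (\<Sum>b\<in>UNIV - {0 :: 'v}. ?N)"
    by (intro sum.cong refl card_B_fibre) (auto simp: K_0)
  also have "\<dots> = (?N - 1) * ?N" by (simp add: card_Diff_singleton)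
  finally have O: "card K * card ?O = card K * ?N + (?N - 1) * ?N" .
  define k N X Y where "k = int (card K)" and "N = int ?N" and "X = int ?X" and "Y = int ?Y"
  have "?N \<ge> 1" by (simp add: Suc_leI finite_UNIV_card_ge_0)
  then have 1: "k * (X\<^sup>2 + (k - 1) * Y\<^sup>2) = k * N + (N - 1) * N"
    using arg_cong[OF O, of int] M MO assms
    by (simp add: k_def N_def X_def Y_def of_nat_diff)
  have 2: "N = X + (k - 1) * Y"
    using arg_cong[OF card_eq_levels, of int] assms
    by (simp add: k_def N_def X_def Y_def of_nat_diff)
  \<comment> \<open>The variance of the level sizes: only two sizes occur, so it is a multiple of (X
    - Y)^2.\<close>
  have "(k - 1) * (X - Y)\<^sup>2 = k * (X\<^sup>2 + (k - 1) * Y\<^sup>2) - (X + (k - 1) * Y)\<^sup>2"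
    by (simp add: power2_eq_square algebra_simps)
  also have "\<dots> = (k - 1) * N" unfolding 1 2[symmetric] by (simp add: power2_eq_square algebra_simps)
  finally have "(X - Y)\<^sup>2 = N" using assms by (simp add: k_def)
  then show ?thesis by (simp add: X_def Y_def N_def)
qed

end

end

section \<open>Sums of traces of squares\<close>

text \<open>With n a power of p, this decides whether the corresponding Frobenius power fixes or
  negates a square root of -1.\<close>

lemma power_of_sqrt_minus_1:
  assumes "i\<^sup>2 = (-1 :: 'a::field)"
  shows "n mod 4 = 1 \<Longrightarrow> i ^ n = i" and "n mod 4 = 3 \<Longrightarrow> i ^ n = - i"
proof -
  have "i ^ 4 = (i\<^sup>2)\<^sup>2" by (simp flip: power_mult)
  then have 4: "i ^ 4 = 1" by (simp add: assms)
  have "i ^ n = i ^ (4 * (n div 4) + n mod 4)" by simp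
  also have "\<dots> = i ^ (n mod 4)" unfolding power_add power_mult 4 by simp
  finally have *: "i ^ n = i ^ (n mod 4)" .
  show "n mod 4 = 1 \<Longrightarrow> i ^ n = i" by (simp add: *)
  have "i ^ 3 = i\<^sup>2 * i" by (simp add: power2_eq_square power3_eq_cube)
  then show "n mod 4 = 3 \<Longrightarrow> i ^ n = - i" by (simp add: * assms)
qed

text \<open>The e-th power map and squaring have the same kernel on nonzero elements, hence images
  of equal size; since e is even, the first image lies in the second, so they agree.\<close>

lemma sum_power_eq_sum_square:
  fixes h :: "'a::{finite,field} \<Rightarrow> int"
  assumes "even e" "e > 0" and ker: "\<And>y :: 'a. y ^ e = 1 \<Longrightarrow> y\<^sup>2 = 1"
  shows "(\<Sum>y\<in>UNIV. h (y ^ e)) = (\<Sum>y\<in>UNIV. h (y\<^sup>2))"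
proof -
  obtain f where f: "e = 2 * f" using assms(1) by blast
  have K: "{t \<in> UNIV - {0 :: 'a}. t ^ e = 1} = {t \<in> UNIV - {0}. t\<^sup>2 = 1}"
    using ker by (auto simp: f power_mult)
  have "card {t \<in> UNIV - {0 :: 'a}. t\<^sup>2 = 1} > 0"
    by (subst card_gt_0_iff) (auto intro: exI[of _ 1])
  moreover have "card {t \<in> UNIV - {0 :: 'a}. t\<^sup>2 = 1} * card ((\<lambda>y. y ^ e) ` (UNIV - {0 :: 'a})) =
      card {t \<in> UNIV - {0 :: 'a}. t\<^sup>2 = 1} * card ((\<lambda>y. y\<^sup>2) ` (UNIV - {0 :: 'a}))"
    using card_power_image[where ?'a = 'a, of e] card_power_image[where ?'a = 'a, of 2]
    unfolding K by (simp only:)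
  ultimately have "card ((\<lambda>y. y ^ e) ` (UNIV - {0 :: 'a})) = card ((\<lambda>y. y\<^sup>2) ` (UNIV - {0 :: 'a}))"
    by (auto simp only: mult_cancel1)
  moreover have "y ^ e = (y ^ f)\<^sup>2" for y :: 'a by (simp add: f mult.commute flip: power_mult)
  then have "(\<lambda>y. y ^ e) ` (UNIV - {0 :: 'a}) \<subseteq> (\<lambda>y. y\<^sup>2) ` (UNIV - {0})" by auto
  ultimately have I: "(\<lambda>y. y ^ e) ` (UNIV - {0 :: 'a}) = (\<lambda>y. y\<^sup>2) ` (UNIV - {0})"
    by (intro card_subset_eq) auto
  have split: "(\<Sum>y\<in>UNIV. h (y ^ d)) = h 0 + (\<Sum>y\<in>UNIV - {0}. h (y ^ d))" if "d > 0" for d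
    using that by (subst sum.remove[of _ 0]) (auto simp: power_0_left)
  show ?thesis
    using split[OF assms(2)] split[OF zero_less_numeral] unfolding sum_power_fibres K I by simp
qed

context odd_prime_power_field
begin

text \<open>A rational substitute for an additive character: on a function whose nonzero values in the
  prime field are equidistributed, it has the same sum as a nontrivial character.\<close>

definition chi :: "'a \<Rightarrow> int" where "chi c = of_bool (c = 0) - of_bool (c = 1)"

lemma chi_0 [simp]: "chi 0 = 1" by (simp add: chi_def)

lemma sum_chi:
  "finite A \<Longrightarrow> (\<Sum>z\<in>A. chi (g z)) = int (card {z\<in>A. g z = 0}) - int (card {z\<in>A. g z = 1})"
  by (simp add: chi_def sum_subtractf sum_of_bool_eq Int_def)

text \<open>Translation by an element of trace 1 carries level 0 onto level 1. The existence of
  \<open>y\<close> is a genuine condition: on the subfield with p^j elements, \<open>Tr\<close> is m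
  / j times the trace of that subfield and vanishes when p divides m / j.\<close>

lemma sum_chi_Tr_fixed:
  assumes "y \<in> fixed j" "Tr y \<noteq> 0"
  shows "(\<Sum>x\<in>fixed j. chi (Tr x)) = 0"
proof -
  define y1 where "y1 = (1 / Tr y) * y"
  have c: "1 / Tr y \<in> P" by (intro P_closed P_1 Tr_in_P)
  have y1: "y1 \<in> fixed j" "Tr y1 = 1"
    using assms subsetD[OF P_subset c, of j] unfolding y1_def tr_scale[OF c]
    by (simp_all only: fixed_mult) simp
  have "card {z \<in> fixed j. Tr z = 0} = card {z \<in> fixed j. Tr z = 1}"
    by (rule bij_betw_same_card[of "\<lambda>z. z + y1"], rule bij_betwI[of _ _ _ "\<lambda>z. z - y1"])
       (use y1 in \<open>auto simp: tr_add tr_diff fixed_add fixed_diff\<close>)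
  then show ?thesis by (simp add: sum_chi)
qed

lemma sum_chi_Tr: "(\<Sum>x\<in>UNIV. chi (Tr x)) = 0"
proof -
  obtain y where "y \<in> fixed m" "Tr y \<noteq> 0" using tr_nonzero[of m] m_pos by auto
  then show ?thesis using sum_chi_Tr_fixed[of y m] by (simp add: fixed_m)
qed

lemma Tr_double:
  assumes "m = 2 * j" "y \<in> fixed j"
  shows "Tr y = 2 * tr p j y"
proof -
  have "(\<Sum>i<j + k. f i) = (\<Sum>i<j. f i) + (\<Sum>i<k. f (j + i))" for k and f :: "nat \<Rightarrow> 'a"
    by (induction k) (simp_all add: add.assoc)
  from this[of "\<lambda>i. y ^ (p ^ i)" j] have "Tr y = tr p j y + (\<Sum>i<j. y ^ (p ^ (j + i)))"
    by (simp add: tr_def assms(1) mult_2)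
  also have "(\<Sum>i<j. y ^ (p ^ (j + i))) = tr p j y"
    using assms(2) unfolding frob_frob[symmetric] fixed_def tr_def by simp
  finally show ?thesis by simp
qed

lemma sum_chi_Tr_half:
  assumes "m = 2 * j"
  shows "(\<Sum>x\<in>fixed j. chi (Tr x)) = 0"
proof -
  obtain y where "y \<in> fixed j" "tr p j y \<noteq> 0" using tr_nonzero[of j] m_pos assms by auto
  then have "Tr y \<noteq> 0" using Tr_double[OF assms] two_neq_0 by simp
  with \<open>y \<in> fixed j\<close> show ?thesis by (rule sum_chi_Tr_fixed)
qed

text \<open>Only x = 0 contributes, because multiplication by a nonzero x permutes the
  subfield.\<close>

lemma sum_chi_hyperbolic:
  assumes "(\<Sum>x\<in>fixed j. chi (Tr x)) = 0"
  shows "(\<Sum>(x, y)\<in>fixed j \<times> fixed j. chi (Tr (x * y))) = int (card (fixed j))"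
proof -
  have "(\<Sum>y\<in>fixed j. chi (Tr (x * y))) = 0" if "x \<in> fixed j" "x \<noteq> 0" for x
  proof -
    have "(\<Sum>y\<in>fixed j. chi (Tr (x * y))) = (\<Sum>y\<in>fixed j. chi (Tr y))"
      by (rule sum.reindex_bij_witness[of _ "\<lambda>y. y / x" "\<lambda>y. x * y"])
         (use that in \<open>auto intro: fixed_mult fixed_divide\<close>)
    with assms show ?thesis by simp
  qed
  then have "(\<Sum>x\<in>fixed j - {0}. \<Sum>y\<in>fixed j. chi (Tr (x * y))) = 0"
    by (intro sum.neutral) auto
  moreover have "(\<Sum>x\<in>fixed j. \<Sum>y\<in>fixed j. chi (Tr (x * y))) =
      (\<Sum>y\<in>fixed j. chi (Tr (0 * y))) + (\<Sum>x\<in>fixed j - {0}. \<Sum>y\<in>fixed j. chi (Tr (x * y)))"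
    by (rule sum.remove) auto
  ultimately show ?thesis by (simp add: sum.cartesian_product)
qed

section \<open>Square roots of -1 and the forms x^2 + y^2 and Tr (x^2)\<close>

lemma four_neq_0: "(4 :: 'a) \<noteq> 0"
  using two_neq_0 mult_eq_0_iff[of "2 :: 'a" 2] by simp

lemma odd_card: "odd (card (UNIV :: 'a set))" using odd_p by (simp add: card_UNIV)

text \<open>There are four fourth roots of unity and at most two square roots of 1; a fourth root
  that is not a square root of 1 squares to -1.\<close>

lemma sqrt_minus_1_exists:
  assumes "p ^ m mod 4 = 1"
  obtains i :: 'a where "i\<^sup>2 = -1"
proof -
  have "4 dvd p ^ m - 1" using assms by presburger
  then have 4: "card {t :: 'a. t ^ 4 = 1} = 4"
    using card_roots_of_unity_field[where ?'a = 'a, of 4] by (simp add: card_UNIV)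
  have "\<not> {t :: 'a. t ^ 4 = 1} \<subseteq> {t. t\<^sup>2 = 1}"
  proof
    assume "{t :: 'a. t ^ 4 = 1} \<subseteq> {t. t\<^sup>2 = 1}"
    then have "card {t :: 'a. t ^ 4 = 1} \<le> card {t :: 'a. t\<^sup>2 = 1}" by (intro card_mono) auto
    also have "\<dots> \<le> 2" by (rule card_nth_roots_le) simp
    finally show False using 4 by simp
  qed
  then obtain t :: 'a where t: "t ^ 4 = 1" "t\<^sup>2 \<noteq> 1" by auto
  have "(t\<^sup>2)\<^sup>2 = 1" using t(1) by (simp flip: power_mult)
  then have "t\<^sup>2 = -1" using t(2) power2_eq_1_iff by blast
  then show ?thesis using that by blast
qed

lemma no_sqrt_minus_1:
  assumes "p ^ m mod 4 = 3"
  shows "(i :: 'a)\<^sup>2 \<noteq> -1"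
proof
  assume i: "i\<^sup>2 = -1"
  have "i = - i" using power_of_sqrt_minus_1(2)[OF i assms] frob_m[of i] by simp
  then have "2 * i = 0" by (metis add.right_inverse mult_2)
  then have "i = 0" using two_neq_0 by simp
  with i show False by simp
qed

text \<open>By Brahmagupta's identity, every nonzero \<open>c = a\<^sup>2 + b\<^sup>2\<close> is the multiplier of a similitude
  of \<open>x\<^sup>2 + y\<^sup>2\<close>.\<close>

lemma sum_two_squares_scale:
  fixes h :: "'a \<Rightarrow> 'b::comm_monoid_add"
  assumes "c \<noteq> 0"
  shows "(\<Sum>(x, y)\<in>UNIV. h (c * (x\<^sup>2 + y\<^sup>2))) = (\<Sum>(x, y)\<in>UNIV. h (x\<^sup>2 + y\<^sup>2))"
proof -
  obtain a b where c: "c = a\<^sup>2 + b\<^sup>2" using sum_of_two_squares_exists[OF odd_card] by blast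
  have "c * (x\<^sup>2 + y\<^sup>2) = (a * x - b * y)\<^sup>2 + (b * x + a * y)\<^sup>2" for x y
    unfolding c by (simp add: power2_eq_square algebra_simps)
  then have "(\<Sum>(x, y)\<in>UNIV. h (c * (x\<^sup>2 + y\<^sup>2))) =
     (\<Sum>(x, y)\<in>UNIV. h ((a * x - b * y)\<^sup>2 + (b * x + a * y)\<^sup>2))" by simp
  also have "\<dots> = (\<Sum>(x, y)\<in>UNIV. h (x\<^sup>2 + y\<^sup>2))"
  proof (rule sum.reindex_bij_witness[of _ "\<lambda>(x, y). ((a * x + b * y) / c, (a * y - b * x) / c)"
        "\<lambda>(x, y). (a * x - b * y, b * x + a * y)"])
    have 1: "a * (a * x - b * y) + b * (b * x + a * y) = c * x"
      "a * (b * x + a * y) - b * (a * x - b * y) = c * y" for x y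
      unfolding c by (simp_all add: power2_eq_square algebra_simps)
    have 2: "a * (a * x + b * y) - b * (a * y - b * x) = c * x"
      "b * (a * x + b * y) + a * (a * y - b * x) = c * y" for x y
      unfolding c by (simp_all add: power2_eq_square algebra_simps)
    show "(case case z of (x, y) \<Rightarrow> (a * x - b * y, b * x + a * y) of
        (x, y) \<Rightarrow> ((a * x + b * y) / c, (a * y - b * x) / c)) = z" for z
      using assms by (cases z) (simp add: 1)
    show "(case case z of (x, y) \<Rightarrow> ((a * x + b * y) / c, (a * y - b * x) / c) of
        (x, y) \<Rightarrow> (a * x - b * y, b * x + a * y)) = z" for z
      using assms 2[of "fst z" "snd z"]
      by (cases z) (simp add: diff_divide_distrib[symmetric] add_divide_distrib[symmetric])
  qed auto
  finally show ?thesis .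
qed

text \<open>If i^2 = -1, then x^2 + y^2 = (x + i y)(x - i y) is a hyperbolic plane. Otherwise 0 is
  represented once and all nonzero values equally often, n times by similitude; q^2 = 1 + n (q - 1)
  gives n = q + 1 and the sum 1 - n = -q.\<close>

lemma sum_chi_two_squares:
  "(\<Sum>(x, y)\<in>UNIV. chi (Tr (x\<^sup>2 + y\<^sup>2))) = (if p ^ m mod 4 = 3 then - int (p ^ m) else int (p ^ m))"
proof (cases "p ^ m mod 4 = 3")
  case False
  have "odd (p ^ m)" using odd_p by simp
  then have "p ^ m mod 4 = 1" using False by presburger
  then obtain i :: 'a where i: "i\<^sup>2 = -1" by (rule sqrt_minus_1_exists)
  then have ii: "i * i = -1" "i * (i * x) = - x" for x
    by (simp_all add: power2_eq_square flip: mult.assoc)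
  have i0: "i \<noteq> 0" using i by auto
  have "(\<Sum>(x, y)\<in>UNIV. chi (Tr (x\<^sup>2 + y\<^sup>2))) =
    (\<Sum>(x, y)\<in>fixed m \<times> fixed m. chi (Tr (x * y)))"
  proof (rule sum.reindex_bij_witness[of _ "\<lambda>(x, y). ((x + y) / 2, (x - y) / (2 * i))"
        "\<lambda>(x, y). (x + i * y, x - i * y)"])
    show "(case case z of (x, y) \<Rightarrow> (x + i * y, x - i * y) of
      (x, y) \<Rightarrow> chi (Tr (x * y))) = (case z of (x, y) \<Rightarrow> chi (Tr (x\<^sup>2 + y\<^sup>2)))" for z
      by (cases z) (simp add: power2_eq_square algebra_simps ii)
  qed (use two_neq_0 four_neq_0 i0 in \<open>auto simp: fixed_m field_simps\<close>)
  also have "\<dots> = int (p ^ m)"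
    using sum_chi_hyperbolic[of m] sum_chi_Tr by (simp add: fixed_m card_UNIV)
  finally show ?thesis using False by simp
next
  case True
  let ?n = "\<lambda>s. card {z \<in> UNIV. (case z of (x, y) \<Rightarrow> x\<^sup>2 + y\<^sup>2) = (s :: 'a)}"
  have n1: "?n c = ?n 1" if "c \<noteq> 0" for c
  proof -
    have card_sum: "?n s = (\<Sum>(x, y)\<in>UNIV. of_bool (x\<^sup>2 + y\<^sup>2 = s))" for s
      by (simp add: case_prod_unfold sum_of_bool_eq Int_def)
    have "?n 1 = (\<Sum>(x, y)\<in>UNIV. of_bool (c * (x\<^sup>2 + y\<^sup>2) = c))"
      unfolding card_sum using that by (intro sum.cong) auto
    also have "\<dots> = ?n c"
      unfolding card_sum by (rule sum_two_squares_scale[OF that, of "\<lambda>s. of_bool (s = c)"])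
    finally show ?thesis by simp
  qed
  have anis: "x = 0 \<and> y = 0" if "x\<^sup>2 + y\<^sup>2 = (0 :: 'a)" for x y
  proof -
    have "(x / y)\<^sup>2 = -1" if "y \<noteq> 0"
      using \<open>x\<^sup>2 + y\<^sup>2 = 0\<close> that by (simp add: power_divide field_simps add_eq_0_iff2)
    then have "y = 0" using no_sqrt_minus_1[OF True] by blast
    then show ?thesis using that by simp
  qed
  have "(case z of (x, y) \<Rightarrow> x\<^sup>2 + y\<^sup>2) = 0 \<longleftrightarrow> z = (0, 0)" for z :: "'a \<times> 'a"
    using anis[of "fst z" "snd z"] by (cases z) auto
  then have n0: "?n 0 = 1" by simp
  define n where "n = int (?n 1)"
  have exp: "(\<Sum>(x, y)\<in>UNIV. h (x\<^sup>2 + y\<^sup>2)) = h 0 + n * (\<Sum>s\<in>UNIV - {0}. h s)" for h :: "'a \<Rightarrow> int"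
  proof -
    have "(\<Sum>(x, y)\<in>UNIV. h (x\<^sup>2 + y\<^sup>2)) = (\<Sum>s\<in>UNIV. int (?n s) * h s)"
      using sum_fun_comp[of "UNIV :: ('a \<times> 'a) set" UNIV "\<lambda>(x, y). x\<^sup>2 + y\<^sup>2" h]
      by (simp add: case_prod_unfold)
    also have "\<dots> = int (?n 0) * h 0 + (\<Sum>s\<in>UNIV - {0}. int (?n s) * h s)"
      by (rule sum.remove) auto
    also have "int (?n 0) * h 0 = h 0" unfolding n0 by simp
    also have "(\<Sum>s\<in>UNIV - {0}. int (?n s) * h s) = (\<Sum>s\<in>UNIV - {0}. n * h s)"
      unfolding n_def by (intro sum.cong refl) (simp only: n1 DiffD2 singleton_iff Diff_iff not_False_eq_True)
    finally show ?thesis by (simp add: sum_distrib_left)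
  qed
  have "(\<Sum>s\<in>UNIV - {0 :: 'a}. 1 :: int) = int (p ^ m) - 1"
    using pj_gt_1[OF m_pos] by (simp add: card_Diff_singleton card_UNIV of_nat_diff)
  then have "int (p ^ m) * int (p ^ m) = 1 + n * (int (p ^ m) - 1)"
    using exp[of "\<lambda>_. 1"] by (simp add: card_UNIV card_cartesian_product flip: UNIV_Times_UNIV)
  then have "(int (p ^ m) - 1) * n = (int (p ^ m) - 1) * (int (p ^ m) + 1)"
    by (simp add: algebra_simps)
  moreover have "int (p ^ m) - 1 \<noteq> 0" using pj_gt_1[OF m_pos] by linarith
  ultimately have n: "n = int (p ^ m) + 1" by simp
  have "(\<Sum>s\<in>UNIV - {0}. chi (Tr s)) = -1"
    using sum_chi_Tr by (simp add: sum.remove[of UNIV "0 :: 'a"])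
  then show ?thesis using exp[of "\<lambda>s. chi (Tr s)"] True by (simp add: n)
qed

text \<open>Put R = p^j. Since Tr (x^2) is the trace of (x^2 + x^(2R)) / 2 and x^2 + x^(2R) = (x - i
  x^R)(x + i x^R), the form splits into two factors. If i^R = -i, they can be scaled into the
  subfield of order R, giving a hyperbolic plane; if i^R = i, they can be scaled to be conjugate,
  giving the norm form z^(R+1).\<close>

lemma sum_chi_Tr_square:
  assumes m: "m = 2 * j"
  shows "(\<Sum>x\<in>UNIV. chi (Tr (x\<^sup>2))) = (if p ^ j mod 4 = 3 then int (p ^ j) else - int (p ^ j))"
proof -
  define R where "R = p ^ j"
  have j: "j > 0" "j dvd m" using m m_pos by auto
  have oddR: "odd R" using odd_p by (simp add: R_def)
  have qR: "p ^ m = R * R" by (simp add: R_def m mult_2 power_add)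
  have q1: "R * R - 1 = (R + 1) * (R - 1)" by (cases R) simp_all
  have "p ^ m mod 4 = 1"
  proof -
    have "R mod 4 = 1 \<or> R mod 4 = 3" using oddR by presburger
    then show ?thesis unfolding qR mod_mult_eq[of R 4 R, symmetric] by auto
  qed
  then obtain i :: 'a where i: "i\<^sup>2 = -1" by (rule sqrt_minus_1_exists)
  have ii: "i * i = -1" "i * (i * x) = - x" for x
    using i by (simp_all add: power2_eq_square flip: mult.assoc)
  have i0: "i \<noteq> 0" using i by auto
  have RR: "(x ^ R) ^ R = x" for x :: 'a
    using frob_m[of x] by (simp add: qR power_mult)
  \<comment> \<open>These are x - i x^R and x + i x^R multiplied by (1 + i) / 2 and (1 - i) / 2,
    which makes the R-th power map fix both or exchange them.\<close>
  define f g where "f x = ((1 + i) * x + (1 - i) * x ^ R) / 2"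
    and "g x = ((1 - i) * x + (1 + i) * x ^ R) / 2" for x :: 'a
  have two_R: "(2 :: 'a) ^ R = 2" using frob_add[of 1 1 j] by (simp add: R_def)
  have frobR: "(x + y) ^ R = x ^ R + y ^ R" "(x - y) ^ R = x ^ R - y ^ R" for x y :: 'a
    by (simp_all add: R_def frob_add frob_diff)
  have fg: "Tr (f x * g x) = Tr (x\<^sup>2)" for x
  proof -
    have "2 * f x = (1 + i) * x + (1 - i) * x ^ R" "2 * g x = (1 - i) * x + (1 + i) * x ^ R"
      using two_neq_0 by (simp_all add: f_def g_def)
    moreover have "4 * (f x * g x) = (2 * f x) * (2 * g x)" by simp
    ultimately have "4 * (f x * g x) =
        ((1 + i) * x + (1 - i) * x ^ R) * ((1 - i) * x + (1 + i) * x ^ R)" by (simp only:)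
    also have "\<dots> = 2 * (x\<^sup>2 + (x\<^sup>2) ^ R)"
      by (simp add: power2_eq_square power_mult_distrib algebra_simps ii)
    finally have "2 * (2 * (f x * g x)) = 2 * (x\<^sup>2 + (x\<^sup>2) ^ R)" by simp
    then have "2 * (f x * g x) = x\<^sup>2 + (x\<^sup>2) ^ R" using two_neq_0 mult_cancel_left by blast
    then have "2 * Tr (f x * g x) = Tr (x\<^sup>2) + Tr ((x\<^sup>2) ^ R)"
      by (metis tr_add mult_2)
    then have "2 * Tr (f x * g x) = 2 * Tr (x\<^sup>2)" unfolding R_def Tr_frob by (simp only: mult_2)
    then show ?thesis using two_neq_0 by simp
  qed
  have inj: "x = y" if "f x = f y" "g x = g y" for x y
  proof -
    have fg_add: "f x + g x = x + x ^ R" "f x - g x = i * (x - x ^ R)" for x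
      using two_neq_0 four_neq_0 by (simp_all add: f_def g_def field_simps)
    have 1: "x + x ^ R = y + y ^ R" "x - x ^ R = y - y ^ R"
      using fg_add[of x] fg_add[of y] that i0 by auto
    have "2 * x = (x + x ^ R) + (x - x ^ R)" by simp
    also have "\<dots> = 2 * y" unfolding 1 by simp
    finally show ?thesis using two_neq_0 by simp
  qed
  show ?thesis
  proof (cases "R mod 4 = 3")
    case True
    have iR: "i ^ R = - i" using power_of_sqrt_minus_1(2)[OF i True] .
    have fix_fg: "f x \<in> fixed j" "g x \<in> fixed j" for x
      unfolding fixed_def R_def[symmetric]
      by (simp_all add: f_def g_def frobR power_divide power_mult_distrib two_R iR RR add.commute)
    have inj2: "inj (\<lambda>x. (f x, g x))" using inj by (auto intro: injI)
    have "range (\<lambda>x. (f x, g x)) = fixed j \<times> fixed j"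
    proof (rule card_subset_eq)
      show "card (range (\<lambda>x. (f x, g x))) = card (fixed j \<times> fixed j)"
        using inj2 j by (simp add: card_image card_cartesian_product card_fixed card_UNIV qR R_def)
    qed (use fix_fg in auto)
    then have "(\<Sum>(x, y)\<in>fixed j \<times> fixed j. chi (Tr (x * y))) =
        (\<Sum>(x, y)\<in>range (\<lambda>x. (f x, g x)). chi (Tr (x * y)))" by simp
    also have "\<dots> = (\<Sum>x\<in>UNIV. chi (Tr (f x * g x)))" using inj2 by (simp add: sum.reindex)
    finally show ?thesis
      using sum_chi_hyperbolic[OF sum_chi_Tr_half[OF m]] True j by (simp add: fg card_fixed R_def)
  next
    case False
    then have R1: "R mod 4 = 1" using oddR by presburger
    have iR: "i ^ R = i" using power_of_sqrt_minus_1(1)[OF i R1] .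
    have gf: "g x = f x ^ R" for x
      by (simp add: f_def g_def frobR power_divide power_mult_distrib two_R iR RR add.commute)
    have injf: "inj f" using inj by (auto intro!: injI simp: gf)
    then have surjf: "f ` UNIV = UNIV" by (simp add: finite_UNIV_inj_surj)
    have "(\<Sum>x\<in>UNIV. chi (Tr (x\<^sup>2))) = (\<Sum>x\<in>UNIV. chi (Tr (f x ^ (R + 1))))"
      unfolding fg[symmetric] gf by (simp add: mult.commute)
    also have "\<dots> = (\<Sum>z\<in>f ` UNIV. chi (Tr (z ^ (R + 1))))" using injf by (simp add: sum.reindex)
    also have "\<dots> = 1 + (\<Sum>z\<in>UNIV - {0}. chi (Tr (z ^ (R + 1))))"
      unfolding surjf by (subst sum.remove[of _ 0]) auto
    \<comment> \<open>The norm covers the nonzero elements of the subfield with fibres of size R +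
      1, so the sum is 1 - (R + 1) = -R.\<close>
    also have "\<dots> = 1 + int (card {t \<in> UNIV - {0 :: 'a}. t ^ (R + 1) = 1}) *
        (\<Sum>s\<in>(\<lambda>y. y ^ (R + 1)) ` (UNIV - {0}). chi (Tr s))"
      by (subst sum_power_fibres[of "\<lambda>s. chi (Tr s)"]) simp
    also have "{t \<in> UNIV - {0 :: 'a}. t ^ (R + 1) = 1} = {t. t ^ (R + 1) = 1}" by auto
    also have "card {t :: 'a. t ^ (R + 1) = 1} = R + 1"
      by (rule card_roots_of_unity_field) (unfold card_UNIV qR q1, rule dvd_triv_left)
    also have "(\<lambda>y. y ^ (R + 1)) ` (UNIV - {0 :: 'a}) = {s. s ^ (R - 1) = 1}"
      by (rule power_image_eq_roots_of_unity)
         (use pj_gt_1[OF j(1)] in \<open>simp_all only: card_UNIV qR q1, simp_all add: R_def\<close>)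
    also have "\<dots> = fixed j - {0}"
      using pj_gt_1[OF j(1)] by (auto simp: fixed_eq_insert R_def power_0_left)
    also have "(\<Sum>s\<in>fixed j - {0}. chi (Tr s)) = -1"
      using sum_chi_Tr_half[OF m] by (simp add: sum.remove[of "fixed j" 0])
    finally show ?thesis using False by (simp add: R_def)
  qed
qed

end

section \<open>The form of the code\<close>

lemma gcd_factors:
  fixes u m :: nat
  assumes "u > 0"
  obtains v a b where "v = gcd m u" "v > 0" "m = v * a" "u = v * b" "coprime a b" "m div gcd m u = a"
  by (rule that[of "gcd m u" "m div gcd m u" "u div gcd m u"])
     (use assms in \<open>auto intro: div_gcd_coprime\<close>)

text \<open>Dividing by v = gcd m u leaves coprime a = m / v and b = u / v, so gcd (4 b) a divides
  4; it is not 4 because 4 does not divide a. Together with \<open>frob_gcd\<close>, being fixed by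
  Frobenius to the 4u-th power implies being fixed by the 2u-th, and for odd a the 2u-th implies the
  u-th.\<close>

lemma gcd_4_dvd:
  fixes u m :: nat
  assumes "u > 0" "odd (m div gcd m u) \<or> (m div gcd m u) mod 4 = 2"
  shows "gcd (4 * u) m dvd 2 * u"
    and "odd (m div gcd m u) \<Longrightarrow> gcd (2 * u) m dvd u"
proof -
  obtain v a b where ab: "m = v * a" "u = v * b" and cop: "coprime a b" and a: "m div gcd m u = a"
    using gcd_factors[OF assms(1)] by metis
  have "gcd (4 * b) a dvd 4"
    using cop coprime_dvd_mult_left_iff[of "gcd (4 * b) a" b 4]
    by (metis coprime_commute coprime_divisors dvd_refl gcd_dvd1 gcd_dvd2)
  moreover have "\<not> 4 dvd gcd (4 * b) a"
  proof
    assume "4 dvd gcd (4 * b) a"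
    then have "4 dvd a" by (rule dvd_trans) simp
    then show False using assms(2) unfolding a by presburger
  qed
  moreover have "d dvd 2" if "d dvd 4" "\<not> 4 dvd d" for d :: nat
  proof -
    have "d \<le> 4" using that(1) by (simp add: dvd_imp_le)
    then have "d \<in> {0, 1, 2, 3, 4}" by auto
    with that show ?thesis by auto
  qed
  ultimately have "gcd (4 * b) a dvd 2" by blast
  then have "v * gcd (4 * b) a dvd v * 2 * b" by (simp add: dvd_mult2)
  moreover have "gcd (4 * u) m = v * gcd (4 * b) a"
    unfolding gcd_mult_distrib_nat by (simp add: ab mult_ac)
  ultimately show "gcd (4 * u) m dvd 2 * u" by (simp add: ab mult_ac)
  assume "odd (m div gcd m u)"
  then have "odd a" by (simp add: a)
  have "coprime (2 * b) a" using \<open>odd a\<close> cop by (simp add: coprime_commute)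
  then have "gcd (2 * b) a = 1" by simp
  moreover have "gcd (2 * u) m = v * gcd (2 * b) a"
    unfolding gcd_mult_distrib_nat by (simp add: ab mult_ac)
  ultimately show "gcd (2 * u) m dvd u" by (simp add: ab)
qed

lemma plus_1_dvd_odd_power_plus_1:
  assumes "odd n"
  shows "(r :: nat) + 1 dvd r ^ n + 1"
proof -
  obtain k where n: "n = 2 * k + 1" using assms by (elim oddE)
  have "r + 1 dvd r ^ (2 * k + 1) + 1"
  proof (induction k)
    case (Suc k)
    have "r ^ (2 * Suc k + 1) + 1 + (r + 1) * r ^ (2 * k + 1) =
        (r ^ (2 * k + 1) + 1) + (r + 1) * r ^ (2 * k + 2)"
      by (simp add: algebra_simps)
    moreover have "r + 1 dvd (r ^ (2 * k + 1) + 1) + (r + 1) * r ^ (2 * k + 2)"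
      by (intro dvd_add Suc dvd_triv_left)
    ultimately show ?case by (metis dvd_add_left_iff dvd_triv_left)
  qed simp
  then show ?thesis by (simp add: n)
qed

lemma sum_UNIV_prod:
  "(\<Sum>(x, y)\<in>(UNIV :: ('b::finite \<times> 'c::finite) set). f x y) = (\<Sum>y\<in>UNIV. \<Sum>x\<in>UNIV. f x y)"
proof -
  have "(\<Sum>(x, y)\<in>UNIV. f x y) = (\<Sum>x\<in>UNIV. \<Sum>y\<in>UNIV. f x y)" by (simp add: sum.cartesian_product)
  also have "\<dots> = (\<Sum>y\<in>UNIV. \<Sum>x\<in>UNIV. f x y)" by (rule sum.swap)
  finally show ?thesis .
qed

locale D2_code = odd_prime_power_field p m F
  for p m :: nat and F :: "'a::{finite,field} itself" +
  fixes u :: nat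
  assumes u_pos: "u > 0"
    and ratio: "odd (m div gcd m u) \<or> (m div gcd m u) mod 4 = 2"
begin

definition Q :: "'a \<times> 'a \<Rightarrow> 'a" where
  "Q z = Tr ((fst z)\<^sup>2 + snd z ^ (p ^ u + 1))"

definition B :: "'a \<times> 'a \<Rightarrow> 'a \<times> 'a \<Rightarrow> 'a" where
  "B z w = Tr (2 * fst z * fst w + (snd z ^ (p ^ u) * snd w + snd z * snd w ^ (p ^ u)))"

text \<open>The pair \<open>(a, b)\<close> with \<open>B z w = Tr (a x + b y)\<close> for \<open>z = (x, y)\<close>; the exponent
  \<open>u (m - 1)\<close> inverts the \<open>u\<close>-th power of the Frobenius map.\<close>

definition dual :: "'a \<times> 'a \<Rightarrow> 'a \<times> 'a" where
  "dual w = (2 * fst w, snd w ^ (p ^ u) + snd w ^ (p ^ (u * (m - 1))))"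

lemma frob_um: "((x :: 'a) ^ (p ^ u)) ^ (p ^ (u * (m - 1))) = x"
  and frob_um': "((x :: 'a) ^ (p ^ (u * (m - 1)))) ^ (p ^ u) = x"
proof -
  have "u + u * (m - 1) = m * u" using m_pos by (cases m) auto
  moreover have "x ^ (p ^ (m * u)) = x" by (rule frob_mult_closed[OF frob_m])
  ultimately show "(x ^ (p ^ u)) ^ (p ^ (u * (m - 1))) = x"
    and "(x ^ (p ^ (u * (m - 1)))) ^ (p ^ u) = x"
    unfolding frob_frob by (simp_all add: add.commute)
qed

text \<open>Under the trace form the adjoint of a Frobenius power is its inverse.\<close>

lemma B_dual: "B z w = Tr (fst (dual w) * fst z + snd (dual w) * snd z)"
proof -
  have "Tr (snd z ^ (p ^ u) * snd w) = Tr ((snd z ^ (p ^ u) * snd w) ^ (p ^ (u * (m - 1))))"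
    by (simp only: Tr_frob)
  also have "\<dots> = Tr (snd z * snd w ^ (p ^ (u * (m - 1))))"
    by (simp only: power_mult_distrib frob_um)
  finally show ?thesis by (simp add: B_def dual_def tr_add algebra_simps)
qed

text \<open>The hypothesis on m / gcd m u gives nondegeneracy here: applying the map twice shows
  that y is fixed by the 4u-th Frobenius power, hence already by the 2u-th, so y = -y.\<close>

lemma frob_2u_radical:
  assumes "(y :: 'a) ^ (p ^ (2 * u)) = - y"
  shows "y = 0"
proof -
  have "2 * u + 2 * u = 4 * u" by simp
  then have "y ^ (p ^ (4 * u)) = (y ^ (p ^ (2 * u))) ^ (p ^ (2 * u))" by (simp only: frob_frob)
  also have "\<dots> = y" by (simp only: assms frob_minus) simp
  finally have "y ^ (p ^ gcd (4 * u) m) = y" by (rule frob_gcd[OF _ frob_m])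
  then have "y ^ (p ^ (2 * u)) = y" by (rule frob_dvd[OF _ gcd_4_dvd(1)[OF u_pos ratio]])
  with assms have "y + y = 0" by (metis add.right_inverse)
  then have "2 * y = 0" by (simp only: mult_2)
  then show ?thesis using two_neq_0 by simp
qed

lemma dual_eq_0:
  assumes "dual w = 0"
  shows "w = 0"
proof -
  have x: "fst w = 0" and y: "snd w ^ (p ^ u) + snd w ^ (p ^ (u * (m - 1))) = 0"
    using assms two_neq_0 by (auto simp: dual_def zero_prod_def)
  have "(snd w ^ (p ^ u)) ^ (p ^ u) + (snd w ^ (p ^ (u * (m - 1)))) ^ (p ^ u) = 0"
    unfolding frob_add[symmetric] y by (simp add: power_0_left)
  then have "(snd w ^ (p ^ u)) ^ (p ^ u) = - snd w"
    unfolding frob_um' by (simp add: eq_neg_iff_add_eq_0)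
  then have "snd w ^ (p ^ (2 * u)) = - snd w" unfolding frob_frob by (simp add: mult_2)
  then have "snd w = 0" by (rule frob_2u_radical)
  with x show ?thesis by (simp add: prod_eq_iff)
qed

sublocale quadratic_form "\<lambda>a z :: 'a \<times> 'a. (a * fst z, a * snd z)" P Q B
proof unfold_locales
  fix z w :: "'a \<times> 'a"
  show "Q (z + w) = Q z + Q w + B z w"
    by (simp add: Q_def B_def frob_add power2_eq_square flip: tr_add) (simp add: algebra_simps)
next
  fix w :: "'a \<times> 'a"
  assume "\<And>z. B z w = 0"
  then have *: "Tr (fst (dual w) * x) = 0" "Tr (snd (dual w) * x) = 0" for x
    using B_dual[of "(x, 0)" w] B_dual[of "(0, x)" w] by simp_all
  have "fst (dual w) = 0" "snd (dual w) = 0" by (rule Tr_nondegenerate, rule *)+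
  then have "dual w = 0" by (simp add: prod_eq_iff)
  then show "w = 0" by (rule dual_eq_0)
next
  fix a z assume a: "a \<in> P"
  have "(a * fst z)\<^sup>2 + (a * snd z) ^ (p ^ u + 1) = a\<^sup>2 * ((fst z)\<^sup>2 + snd z ^ (p ^ u + 1))"
    using P_frob[OF a, of u] by (simp add: power_mult_distrib power2_eq_square algebra_simps)
  moreover have "a\<^sup>2 \<in> P" using a by (simp add: power2_eq_square P_closed)
  ultimately show "Q (a * fst z, a * snd z) = a\<^sup>2 * Q z"
    by (simp only: Q_def fst_conv snd_conv tr_scale)
next
  fix a z w assume a: "a \<in> P"
  have "B (a * fst z, a * snd z) w = Tr (a * (fst (dual w) * fst z + snd (dual w) * snd z))"
    unfolding B_dual by (simp add: algebra_simps)
  then show "B (a * fst z, a * snd z) w = a * B z w" unfolding B_dual tr_scale[OF a] .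
next
  fix z z' w :: "'a \<times> 'a"
  show "B (z + z') w = B z w + B z' w"
    unfolding B_dual tr_add[symmetric] by (simp add: algebra_simps)
qed (auto simp: P_closed two_neq_0 Q_def Tr_in_P algebra_simps prod_eq_iff)

text \<open>If y^(p^u + 1) = 1, then the u-th Frobenius power inverts y and the 2u-th fixes it. For
  an odd ratio the u-th fixes it too, so y = 1 / y and the kernel is that of squaring.\<close>

lemma sum_squares_eq:
  fixes h :: "'a \<Rightarrow> int"
  assumes "odd (m div gcd m u)"
  shows "(\<Sum>(x, y)\<in>UNIV. h (x\<^sup>2 + y ^ (p ^ u + 1))) = (\<Sum>(x, y)\<in>UNIV. h (x\<^sup>2 + y\<^sup>2))"
  unfolding sum_UNIV_prod
proof (rule sum_power_eq_sum_square[of "p ^ u + 1" "\<lambda>s. \<Sum>x\<in>UNIV. h (x\<^sup>2 + s)"])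
  fix y :: 'a assume y: "y ^ (p ^ u + 1) = 1"
  then have y0: "y \<noteq> 0" by auto
  then have 1: "y ^ (p ^ u) = 1 / y" using y by (simp add: field_simps)
  have "y ^ (p ^ (2 * u)) = (y ^ (p ^ u)) ^ (p ^ u)" unfolding frob_frob by (simp add: mult_2)
  also have "\<dots> = y" unfolding 1 power_divide by simp
  finally have "y ^ (p ^ gcd (2 * u) m) = y" by (rule frob_gcd[OF _ frob_m])
  then have "y ^ (p ^ u) = y" by (rule frob_dvd[OF _ gcd_4_dvd(2)[OF u_pos ratio assms]])
  with 1 y0 show "y\<^sup>2 = 1" by (simp add: power2_eq_square field_simps)
qed (use odd_p in auto)

section \<open>The value distribution of the form\<close>

lemma card_Q_eq_sum: "int (card {z. Q z = c}) = (\<Sum>(x, y)\<in>UNIV. of_bool (Tr (x\<^sup>2 + y ^ (p ^ u + 1)) = c))"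
  by (simp add: case_prod_unfold sum_of_bool_eq Q_def)

lemma card_Q_diff_eq_sum_chi:
  "int (card {z. Q z = 0}) - int (card {z. Q z = 1}) =
    (\<Sum>(x, y)\<in>UNIV. chi (Tr (x\<^sup>2 + y ^ (p ^ u + 1))))"
  using sum_chi[of UNIV Q] by (simp add: case_prod_unfold Q_def)

lemma P_power_minus_1:
  assumes "c \<in> P" "c \<noteq> 0" "p - 1 dvd k"
  shows "c ^ k = 1"
proof -
  have "c * c ^ (p - 1) = c * 1" using P_frob[OF assms(1), of 1] by (simp flip: power_Suc)
  then have "c ^ (p - 1) = 1" using assms(2) by simp
  then show ?thesis using assms(3) by (auto simp: power_mult elim!: dvdE)
qed

text \<open>Since m / v is even, coprimality makes u / v odd. Both u and m / 2 are thus odd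
  multiples of v, so p^v + 1 divides p^u + 1 and p^(m/2) + 1.\<close>

lemma even_ratio:
  assumes "(m div gcd m u) mod 4 = 2"
  obtains v j k n where "v = gcd m u" "v > 0" "m = 2 * j" "j = v * k" "odd k" "u = v * n" "odd n"
proof -
  obtain v a b where v: "v = gcd m u" "v > 0" and ab: "m = v * a" "u = v * b"
    and cop: "coprime a b" and "m div gcd m u = a"
    using gcd_factors[OF u_pos] by metis
  then have a: "a mod 4 = 2" using assms by simp
  then have "even a" "odd (a div 2)" by presburger+
  then obtain k where k: "a = 2 * k" by blast
  with \<open>odd (a div 2)\<close> have "odd k" by simp
  have "odd b" using cop \<open>even a\<close> coprime_common_divisor[of a b 2] by auto
  show ?thesis
    by (rule that[OF v, of "v * k" k b]) (use ab k \<open>odd k\<close> \<open>odd b\<close> in auto)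
qed

text \<open>A similitude of multiplier c maps level 1 onto level c. For an odd ratio it comes from
  x^2 + y^2; otherwise it is diagonal, (x, y) -> (s x, t y) with s^2 = c and t^(p^u + 1) =
  c.\<close>

lemma card_Q_levels:
  assumes "c \<in> P" "c \<noteq> 0"
  shows "card {z. Q z = c} = card {z. Q z = 1}"
proof (cases "odd (m div gcd m u)")
  case True
  have "int (card {z. Q z = 1}) = (\<Sum>(x, y)\<in>UNIV. of_bool (Tr (x\<^sup>2 + y\<^sup>2) = 1))"
    unfolding card_Q_eq_sum by (rule sum_squares_eq[OF True])
  also have "\<dots> = (\<Sum>(x, y)\<in>UNIV. of_bool (Tr (c * (x\<^sup>2 + y\<^sup>2)) = c))"
    using assms by (simp only: tr_scale) simp
  also have "\<dots> = (\<Sum>(x, y)\<in>UNIV. of_bool (Tr (x\<^sup>2 + y\<^sup>2) = c))"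
    by (rule sum_two_squares_scale[OF assms(2)])
  also have "\<dots> = int (card {z. Q z = c})"
    unfolding card_Q_eq_sum by (rule sum_squares_eq[OF True, symmetric])
  finally show ?thesis by simp
next
  case False
  with ratio have "(m div gcd m u) mod 4 = 2" by simp
  then obtain v j k n where vj: "v > 0" "m = 2 * j" "j = v * k" "odd k" "u = v * n" "odd n"
    by (rule even_ratio)
  define R where "R = p ^ j"
  have qR: "p ^ m - 1 = (R + 1) * (R - 1)"
    by (simp add: R_def vj(2) mult_2 power_add, cases "p ^ j") simp_all
  have pR: "p - 1 dvd R - 1" unfolding R_def by (rule minus_1_dvd_power_minus_1)
  have R1: "R > 1" unfolding R_def using vj m_pos by (intro pj_gt_1) auto
  \<comment> \<open>Elements of the prime field satisfy c^(R - 1) = 1, as p - 1 divides R - 1. With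
    q - 1 = d l (R - 1) this makes c a d-th power for each divisor d of R + 1.\<close>
  have root: "\<exists>t. t ^ d = c" if d: "R + 1 = d * l" for d l
  proof -
    have dl: "d > 0" "l > 0" using d by (auto intro: gr0I)
    have "c ^ (l * (R - 1)) = 1" by (rule P_power_minus_1[OF assms dvd_mult[OF pR]])
    then have "c \<in> {s. s ^ (l * (R - 1)) = 1}" by simp
    moreover have "(\<lambda>y. y ^ d) ` (UNIV - {0 :: 'a}) = {s. s ^ (l * (R - 1)) = 1}"
      by (rule power_image_eq_roots_of_unity) (use dl R1 in \<open>simp_all only: card_UNIV qR d\<close>, auto)
    ultimately have "c \<in> (\<lambda>y. y ^ d) ` (UNIV - {0})" by (simp only:)
    then show ?thesis by auto
  qed
  have "even (R + 1)" using odd_p by (simp add: R_def)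
  then obtain s where s: "s\<^sup>2 = c" using root by blast
  have "p ^ v + 1 dvd R + 1"
    unfolding R_def vj(3) power_mult by (rule plus_1_dvd_odd_power_plus_1[OF vj(4)])
  then obtain t where t: "t ^ (p ^ v + 1) = c" using root by blast
  have st0: "s \<noteq> 0" "t \<noteq> 0" using s t assms by auto
  \<comment> \<open>The v-th Frobenius power sends t to c / t, hence acts on t as an involution; u
    is an odd multiple of v, so the u-th does the same.\<close>
  have tv: "t ^ (p ^ v) = c / t" using t st0 by (simp add: field_simps)
  have "t ^ (p ^ (v + v)) = (t ^ (p ^ v)) ^ (p ^ v)" by (simp only: frob_frob)
  also have "\<dots> = t" unfolding tv power_divide P_frob[OF assms(1)] using assms(2) by simp
  finally have t2v: "t ^ (p ^ (v + v)) = t" .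
  obtain n' where n: "n = 2 * n' + 1" using vj(6) by (elim oddE)
  have "u = (v + v) * n' + v" by (simp add: vj(5) n algebra_simps)
  then have "t ^ (p ^ u) = (t ^ (p ^ ((v + v) * n'))) ^ (p ^ v)" by (simp only: frob_frob)
  also have "\<dots> = c / t" unfolding frob_mult_closed[OF t2v] tv ..
  finally have te: "t ^ (p ^ u + 1) = c" using st0 by simp
  have scale: "Q (s * x, t * y) = c * Q (x, y)" for x y
  proof -
    have "(s * x)\<^sup>2 + (t * y) ^ (p ^ u + 1) = c * (x\<^sup>2 + y ^ (p ^ u + 1))"
      unfolding power_mult_distrib s te by (simp add: algebra_simps)
    then show ?thesis by (simp only: Q_def fst_conv snd_conv tr_scale[OF assms(1)])
  qed
  have "bij_betw (\<lambda>(x, y). (s * x, t * y)) {z. Q z = 1} {z. Q z = c}"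
  proof (rule bij_betwI[of _ _ _ "\<lambda>(x, y). (x / s, y / t)"])
    show "(\<lambda>(x, y). (s * x, t * y)) \<in> {z. Q z = 1} \<rightarrow> {z. Q z = c}" by (auto simp: scale)
    have "Q (x / s, y / t) = 1" if "Q (x, y) = c" for x y
      using scale[of "x / s" "y / t"] that st0 assms(2) by simp
    then show "(\<lambda>(x, y). (x / s, y / t)) \<in> {z. Q z = c} \<rightarrow> {z. Q z = 1}" by auto
  qed (use st0 in auto)
  then show ?thesis using bij_betw_same_card by metis
qed

text \<open>If \<open>m / v \<equiv> 2\<close> modulo 4, where \<open>v = gcd m u\<close>, the difference is known up to sign, and the sign
  is determined modulo \<open>p ^ v + 1\<close> since all fibres of \<open>y \<mapsto> y ^ (p ^ u + 1)\<close> over nonzero elements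
  have size divisible by \<open>p ^ v + 1\<close>.\<close>

lemma card_Q_diff:
  "int (card {z. Q z = 0}) - int (card {z. Q z = 1}) =
    (if p mod 4 = 3 \<and> odd (gcd m u) then - int (p ^ m) else int (p ^ m))"
proof -
  have mod4: "p ^ i mod 4 = 3 \<longleftrightarrow> p mod 4 = 3 \<and> odd i" for i
  proof -
    have "p mod 4 = 1 \<or> p mod 4 = 3" using odd_p by presburger
    moreover have "p ^ i mod 4 = (p mod 4) ^ i mod 4" by (simp only: power_mod)
    moreover have "(3 :: nat) ^ i mod 4 = (if odd i then 3 else 1)"
    proof (induction i)
      case (Suc i)
      have "(3 :: nat) ^ Suc i mod 4 = 3 * (3 ^ i mod 4) mod 4"
        by (simp only: power_Suc mod_mult_right_eq)
      then show ?case using Suc by simp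
    qed simp
    ultimately show ?thesis by auto
  qed
  show ?thesis
  proof (cases "odd (m div gcd m u)")
    case True
    have "m = gcd m u * (m div gcd m u)" by simp
    then have "odd m \<longleftrightarrow> odd (gcd m u)" using True by (metis even_mult_iff)
    then show ?thesis
      unfolding card_Q_diff_eq_sum_chi sum_squares_eq[OF True, of "\<lambda>s. chi (Tr s)"] sum_chi_two_squares
      by (simp add: mod4)
  next
    case False
    with ratio have "(m div gcd m u) mod 4 = 2" by simp
    then obtain v j k n where vj: "v = gcd m u" "v > 0" "m = 2 * j" "j = v * k" "odd k"
        "u = v * n" "odd n"
      by (rule even_ratio)
    define S where "S = int (card {z. Q z = 0}) - int (card {z. Q z = 1})"
    define R where "R = int (p ^ j)"
    define d where "d = p ^ v + 1"
    define T where "T = (\<Sum>x\<in>UNIV. chi (Tr (x\<^sup>2)))"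
    have qR: "int (p ^ m) = R * R" by (simp add: R_def vj(3) mult_2 power_add)
    have "S\<^sup>2 = int (card (UNIV :: ('a \<times> 'a) set))"
      unfolding S_def using p_ge3 by (intro card_level_difference_squared card_Q_levels) (simp_all add: card_P)
    also have "\<dots> = (R * R)\<^sup>2"
      by (simp add: card_UNIV card_cartesian_product power2_eq_square flip: UNIV_Times_UNIV qR)
    finally have S: "S = R * R \<or> S = - (R * R)" by (simp add: power2_eq_iff)
    have dR: "int d dvd R + 1"
    proof -
      have "d dvd p ^ j + 1"
        unfolding d_def vj(4) power_mult by (rule plus_1_dvd_odd_power_plus_1[OF vj(5)])
      then have "int d dvd int (p ^ j + 1)" by (simp only: of_nat_dvd_iff)
      then show ?thesis by (simp add: R_def add.commute)
    qed
    have "d dvd p ^ u + 1"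
      unfolding d_def vj(6) power_mult by (rule plus_1_dvd_odd_power_plus_1[OF vj(7)])
    then obtain f where f: "p ^ u + 1 = d * f" by blast
    have dq: "d dvd p ^ m - 1"
    proof -
      have "int (p ^ m - 1) = (R + 1) * (R - 1)"
        using pj_gt_1[OF m_pos] by (simp add: of_nat_diff algebra_simps flip: qR)
      then have "int d dvd int (p ^ m - 1)" using dR by simp
      then show ?thesis by (simp only: of_nat_dvd_iff)
    qed
    \<comment> \<open>The term y = 0 is T and the nonzero y come in fibres of size d, so S and T
      agree modulo d.\<close>
    have "S = (\<Sum>y\<in>UNIV. \<Sum>x\<in>UNIV. chi (Tr (x\<^sup>2 + (y ^ d) ^ f)))"
      unfolding S_def card_Q_diff_eq_sum_chi sum_UNIV_prod f by (simp only: power_mult)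
    also have "\<dots> = (\<Sum>x\<in>UNIV. chi (Tr (x\<^sup>2 + (0 ^ d) ^ f))) +
        (\<Sum>y\<in>UNIV - {0}. \<Sum>x\<in>UNIV. chi (Tr (x\<^sup>2 + (y ^ d) ^ f)))"
      by (rule sum.remove) auto
    also have "(\<Sum>x\<in>UNIV. chi (Tr (x\<^sup>2 + (0 ^ d) ^ f))) = T"
      unfolding T_def power_mult[symmetric] f[symmetric] by simp
    also have "(\<Sum>y\<in>UNIV - {0}. \<Sum>x\<in>UNIV. chi (Tr (x\<^sup>2 + (y ^ d) ^ f))) =
        int (card {t \<in> UNIV - {0 :: 'a}. t ^ d = 1}) *
        (\<Sum>s\<in>(\<lambda>y. y ^ d) ` (UNIV - {0}). \<Sum>x\<in>UNIV. chi (Tr (x\<^sup>2 + s ^ f)))"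
      by (rule sum_power_fibres)
    also have "{t \<in> UNIV - {0 :: 'a}. t ^ d = 1} = {t. t ^ d = 1}"
      by (auto simp: d_def)
    also have "card {t :: 'a. t ^ d = 1} = d"
      by (rule card_roots_of_unity_field) (unfold card_UNIV, rule dq)
    finally have ST: "int d dvd S - T" by simp
    have T: "T = (if p ^ j mod 4 = 3 then R else - R)"
      unfolding T_def R_def by (rule sum_chi_Tr_square[OF vj(3)])
    \<comment> \<open>Modulo d, R is -1 and R^2 is 1. As d > 2 separates 1 from -1, the congruence
      of S and T leaves only S = -R T.\<close>
    have d3: "int d > 2" using p_ge3 self_le_power[of p v] vj(2) by (simp add: d_def)
    have no: False if "int d dvd R * R - R"
    proof -
      have "int d dvd (R + 1) * (R - 2) - (R * R - R)" by (rule dvd_diff[OF dvd_mult2[OF dR] that])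
      also have "(R + 1) * (R - 2) - (R * R - R) = -2" by (simp add: algebra_simps)
      finally have "int d \<le> 2" using zdvd_imp_le[of "int d" 2] by simp
      with d3 show False by simp
    qed
    have no': False if "int d dvd R - R * R"
      using no that dvd_minus_iff[of "int d" "R - R * R"] by simp
    have "S = (if p ^ j mod 4 = 3 then - (R * R) else R * R)"
      using S ST no no' by (auto simp: T)
    moreover have "odd j \<longleftrightarrow> odd v" using vj(4,5) by simp
    ultimately show ?thesis unfolding S_def[symmetric] qR vj(1)[symmetric] by (simp add: mod4)
  qed
qed

end

section \<open>The weight distribution\<close>

context D2_code
begin

lemma card_V: "card (UNIV :: ('a \<times> 'a) set) = p ^ m * p ^ m"
  by (simp add: card_UNIV card_cartesian_product flip: UNIV_Times_UNIV)

text \<open>Eliminates Y from the two linear relations through p X = (X + (p - 1) Y) + (p - 1) (X -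
  Y).\<close>

lemma card_Q_0:
  "card {z. Q z = 0} = (if p mod 4 = 3 \<and> odd (gcd m u)
     then p * p ^ (m - 1) * p ^ (m - 1) - (p - 1) * p ^ (m - 1)
     else p * p ^ (m - 1) * p ^ (m - 1) + (p - 1) * p ^ (m - 1))"
proof -
  define s where "s = p ^ (m - 1)"
  have q: "p ^ m = p * s" using m_pos by (cases m) (simp_all add: s_def)
  have spos: "s > 0" by (simp add: s_def)
  define X Y where "X = int (card {z. Q z = 0})" and "Y = int (card {z. Q z = 1})"
  define \<epsilon> :: int where "\<epsilon> = (if p mod 4 = 3 \<and> odd (gcd m u) then - 1 else 1)"
  have 1: "X - Y = \<epsilon> * (int p * int s)"
    unfolding X_def Y_def \<epsilon>_def card_Q_diff q by auto
  have "p * s * (p * s) = card {z. Q z = 0} + (p - 1) * card {z. Q z = 1}"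
    using card_eq_levels[OF card_Q_levels] by (simp add: card_V card_P q)
  from arg_cong[OF this, of int] have "int p * int s * (int p * int s) = X + (int p - 1) * Y"
    using p_ge3 by (simp add: X_def Y_def of_nat_diff)
  then have "int p * X = int p * s * (int p * s) + (int p - 1) * (X - Y)"
    by (simp add: algebra_simps)
  then have "int p * X = int p * (int p * s * s + \<epsilon> * ((int p - 1) * s))"
    unfolding 1 by (simp add: algebra_simps)
  then have X: "X = int p * s * s + \<epsilon> * ((int p - 1) * s)" using p_gt0 by simp
  have p1: "int (p - 1) = int p - 1" using p_ge3 by (simp add: of_nat_diff)
  show ?thesis
  proof (cases "p mod 4 = 3 \<and> odd (gcd m u)")
    case True
    then have e: "\<epsilon> = -1" unfolding \<epsilon>_def by (rule if_P)
    have "int (card {z. Q z = 0} + (p - 1) * s) = int (p * s * s)"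
      unfolding of_nat_add of_nat_mult p1 X_def[symmetric] X e by simp
    then have "card {z. Q z = 0} + (p - 1) * s = p * s * s" by (simp only: of_nat_eq_iff)
    then show ?thesis unfolding if_P[OF True] s_def by simp
  next
    case False
    then have e: "\<epsilon> = 1" unfolding \<epsilon>_def by (rule if_not_P)
    have "int (card {z. Q z = 0}) = int (p * s * s + (p - 1) * s)"
      unfolding of_nat_add of_nat_mult p1 X_def[symmetric] X e by simp
    then have "card {z. Q z = 0} = p * s * s + (p - 1) * s" by (simp only: of_nat_eq_iff)
    then show ?thesis unfolding if_not_P[OF False] s_def by simp
  qed
qed

text \<open>Indexing codewords through \<open>dual\<close> turns their entries into
  \<open>B z w\<close>, so that \<open>Q w\<close> governs the weight.\<close>

definition word :: "'a \<times> 'a \<Rightarrow> 'a \<times> 'a \<Rightarrow> 'a" where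
  "word w = cw p m u (fst (dual w)) (snd (dual w))"

lemma D2_eq: "D2 p m u = {z. z \<noteq> 0 \<and> Q z = 0}"
  by (auto simp: D2_def Q_def zero_prod_def)

lemma word_eq: "word w z = (if z \<in> D2 p m u then B z w else 0)"
  by (simp add: word_def cw_def B_dual)

lemma dual_diff: "dual (w - w') = dual w - dual w'"
  by (simp add: dual_def frob_diff prod_eq_iff algebra_simps)

lemma surj_dual: "surj dual"
proof -
  have "inj dual"
  proof (rule injI)
    fix w w' assume "dual w = dual w'"
    then have "dual (w - w') = 0" by (simp add: dual_diff)
    then show "w = w'" using dual_eq_0 by fastforce
  qed
  then show ?thesis by (simp add: finite_UNIV_inj_surj)
qed

lemma code_eq: "code p m u = range word"
proof -
  have "cw p m u a b \<in> range word" for a b :: 'a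
  proof -
    obtain w where "dual w = (a, b)" using surj_dual by (metis surjD)
    then have "cw p m u a b = word w" by (simp add: word_def)
    then show ?thesis by simp
  qed
  then show ?thesis by (auto simp: code_def word_def)
qed

lemma hweight_word: "hweight (D2 p m u) (word w) = card {z. Q z = 0 \<and> B z w \<noteq> 0}"
  unfolding hweight_def by (rule arg_cong[where f = card]) (auto simp: word_eq D2_eq)

lemma hweight_isotropic:
  assumes "w \<noteq> 0" "Q w = 0"
  shows "hweight (D2 p m u) (word w) = (p - 1) * (p ^ (m - 1) * p ^ (m - 1))"
proof -
  have q: "p ^ m = p * p ^ (m - 1)" using m_pos by (cases m) simp_all
  have "p ^ 2 * hweight (D2 p m u) (word w) = (p - 1) * (p ^ m * p ^ m)"
    using card_isotropic_off_hyperplane[OF assms] by (simp add: card_P card_V hweight_word)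
  also have "\<dots> = p ^ 2 * ((p - 1) * (p ^ (m - 1) * p ^ (m - 1)))"
    unfolding q by (simp only: power2_eq_square mult_ac)
  finally show ?thesis by simp
qed

lemma hweight_anisotropic:
  assumes "Q w \<noteq> 0"
  shows "hweight (D2 p m u) (word w) = card {z. Q z = 0} - p ^ (m - 1) * p ^ (m - 1)"
proof -
  have q: "p ^ m = p * p ^ (m - 1)" using m_pos by (cases m) simp_all
  have "p ^ 2 * card {z. Q z = 0 \<and> B z w = 0} = p ^ m * p ^ m"
    using card_isotropic_on_hyperplane[OF card_Q_levels assms] by (simp add: card_P card_V)
  also have "\<dots> = p ^ 2 * (p ^ (m - 1) * p ^ (m - 1))"
    unfolding q by (simp only: power2_eq_square mult_ac)
  finally have "card {z. Q z = 0 \<and> B z w = 0} = p ^ (m - 1) * p ^ (m - 1)" by simp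
  moreover have "{z. Q z = 0 \<and> B z w \<noteq> 0} = {z. Q z = 0} - {z. Q z = 0 \<and> B z w = 0}" by auto
  ultimately show ?thesis by (simp add: hweight_word card_Diff_subset subset_eq)
qed

lemma word_0: "word 0 = (\<lambda>_. 0)"
  by (auto simp: word_eq)

text \<open>Injectivity yields dimension 2m. Positivity of the weights stays a premise because it
  fails in the case excluded by the theorem, where no coordinates exist.\<close>

lemma inj_word:
  assumes "\<And>w. w \<noteq> 0 \<Longrightarrow> hweight (D2 p m u) (word w) \<noteq> 0"
  shows "inj word"
proof (rule injI)
  fix w w' assume eq: "word w = word w'"
  have "word (w - w') z = 0" for z using fun_cong[OF eq, of z] by (auto simp: word_eq B_diff_right split: if_splits)
  then have "hweight (D2 p m u) (word (w - w')) = 0" by (simp add: hweight_def)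
  then show "w = w'" using assms[of "w - w'"] by auto
qed

end

theorem theorem5:
  fixes p m u :: nat
    and F :: "'a::{finite,field} itself"
  assumes "prime p" and "odd p" and "m > 0" and "u > 0"
    and "card (UNIV :: 'a set) = p ^ m"
    and "odd (m div gcd m u) \<or> (m div gcd m u) mod 4 = 2"
    and "\<not> (m = 1 \<and> p mod 4 = 3)"
  shows "let v = gcd m u;
             special = (p mod 4 = 3 \<and> odd v);
             n = (if special then (p ^ m + 1) * (p ^ (m - 1) - 1)
                  else (p ^ m - 1) * (p ^ (m - 1) + 1));
             w1 = (p - 1) * p ^ (2 * m - 2);
             w2 = (if special then (p - 1) * (p ^ (2 * m - 2) - p ^ (m - 1))
                   else (p - 1) * (p ^ (2 * m - 2) + p ^ (m - 1)));
             A1 = (if special then (p ^ m + 1) * (p ^ (m - 1) - 1)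
                   else (p ^ m - 1) * (p ^ (m - 1) + 1));
             A2 = (if special then (p ^ m + 1) * p ^ (m - 1) * (p - 1)
                   else (p ^ m - 1) * p ^ (m - 1) * (p - 1));
             C = (code p m u :: ('a \<times> 'a \<Rightarrow> 'a) set)
         in card (D2 p m u :: ('a \<times> 'a) set) = n
          \<and> (\<forall>c\<in>C. \<forall>d\<in>C. (\<lambda>z. c z + d z) \<in> C)
          \<and> (\<forall>c\<in>C. \<forall>z. c z \<in> {of_nat k | k. k < p})
          \<and> card C = p ^ (2 * m)
          \<and> {hweight (D2 p m u) c | c. c \<in> C \<and> c \<noteq> (\<lambda>_. 0)} = {w1, w2}
          \<and> w1 \<noteq> w2
          \<and> wmult p m u 0 F = 1
          \<and> wmult p m u w1 F = A1
          \<and> wmult p m u w2 F = A2"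
proof -
  interpret D2_code p m F u using assms by unfold_locales auto
  define s where "s = p ^ (m - 1)"
  define special where "special \<longleftrightarrow> p mod 4 = 3 \<and> odd (gcd m u)"
  define X where "X = card {z. Q z = 0}"
  define W where "W w = hweight (D2 p m u) (word w)" for w
  define w1 where "w1 = (p - 1) * p ^ (2 * m - 2)"
  define w2 where "w2 = (if special then (p - 1) * (p ^ (2 * m - 2) - p ^ (m - 1))
    else (p - 1) * (p ^ (2 * m - 2) + p ^ (m - 1)))"
  define A1 where "A1 = (if special then (p ^ m + 1) * (p ^ (m - 1) - 1)
    else (p ^ m - 1) * (p ^ (m - 1) + 1))"
  define A2 where "A2 = (if special then (p ^ m + 1) * p ^ (m - 1) * (p - 1)
    else (p ^ m - 1) * p ^ (m - 1) * (p - 1))"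
  have q: "p ^ m = p * s" using assms(3) by (cases m) (simp_all add: s_def)
  have ss: "p ^ (2 * m - 2) = s * s"
    by (simp add: s_def diff_mult_distrib2 flip: power_add mult_2)
  obtain r where r: "p = Suc r" "r \<ge> 2" using p_ge3 by (cases p) auto
  have s1: "s \<ge> 1" by (simp add: s_def Suc_leI)
  \<comment> \<open>The exclusion of m = 1 with p = 3 modulo 4 enters here; s = 1 would make
    \<open>w2\<close> and \<open>A1\<close> zero.\<close>
  have s_special: "s \<ge> 2" if special
  proof -
    have "m \<noteq> 1" using that assms(7) by (auto simp: special_def)
    then have "m - 1 > 0" using assms(3) by auto
    from pj_gt_1[OF this] show ?thesis by (simp add: s_def)
  qed
  \<comment> \<open>Writing p = r + 1 and s = t + 1 removes the truncated subtractions from the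
    identities below.\<close>
  obtain t where t: "s = Suc t" using s1 by (cases s) auto
  have X: "X = (if special then p * s * s - (p - 1) * s else p * s * s + (p - 1) * s)"
    unfolding X_def special_def s_def by (rule card_Q_0)
  have ts: "t > 0" if special using s_special[OF that] t by simp
  have w1: "w1 = r * s * s" unfolding w1_def ss by (simp add: r)
  have w2: "w2 = (if special then r * s * t else r * s * Suc s)"
    unfolding w2_def ss s_def[symmetric] by (simp add: r t algebra_simps)
  \<comment> \<open>The extra 1 is the zero vector, isotropic but not a coordinate position.\<close>
  have X1: "X = Suc A1"
    unfolding X A1_def q s_def[symmetric] by (simp add: r t algebra_simps)
  \<comment> \<open>For anisotropic w, exactly s * s isotropic vectors are orthogonal to w; the
    remaining ones make up the weight.\<close>
  have X2: "X = s * s + w2"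
    unfolding X w2 by (simp add: r t algebra_simps)
  have XA2: "p ^ m * p ^ m = X + A2"
    unfolding X A2_def q s_def[symmetric] by (simp add: r t algebra_simps)
  have w1_pos: "w1 > 0" using s1 r by (simp add: w1)
  have w2_pos: "w2 > 0" using s1 ts r by (cases special) (simp_all add: w2)
  have w12: "w1 \<noteq> w2" using s1 r by (simp add: w1 w2 t)
  have W: "W w = (if w = 0 then 0 else if Q w = 0 then w1 else w2)" for w
  proof -
    have "W 0 = 0" by (simp add: W_def word_0 hweight_def)
    moreover have "W w = w1" if "w \<noteq> 0" "Q w = 0"
      using hweight_isotropic[OF that] by (simp add: W_def w1_def ss s_def)
    moreover have "W w = w2" if "Q w \<noteq> 0"
      using hweight_anisotropic[OF that] X2 by (simp add: W_def X_def s_def)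
    ultimately show ?thesis using Q_0 by auto
  qed
  have inj: "inj word"
    by (rule inj_word) (use W w1_pos w2_pos in \<open>auto simp: W_def\<close>)
  have W_eq: "{w. W w = 0} = {0}" "{w. W w = w1} = {z. Q z = 0} - {0}" "{w. W w = w2} = - {z. Q z = 0}"
    using w1_pos w2_pos w12 by (auto simp: W split: if_splits)
  have cardX: "card ({z. Q z = 0} - {0}) = A1"
    using X1 by (simp add: X_def card_Diff_singleton)
  have cardnX: "card (- {z. Q z = 0}) = A2"
    using XA2 card_V by (simp add: X_def Compl_eq_Diff_UNIV card_Diff_subset)
  \<comment> \<open>By injectivity multiplicities count vectors w. The length and the multiplicity
    of \<open>w1\<close> agree because both count nonzero isotropic vectors.\<close>
  have wmult: "wmult p m u k F = card {w. W w = k}" for k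
  proof -
    have "{c \<in> code p m u. hweight (D2 p m u) c = k} = word ` {w. W w = k}"
      by (auto simp: code_eq W_def)
    then show ?thesis using inj by (simp add: wmult_def card_image inj_on_subset)
  qed
  have D2: "card (D2 p m u :: ('a \<times> 'a) set) = A1"
  proof -
    have "D2 p m u = {z. Q z = 0} - {0}" by (auto simp: D2_eq)
    then show ?thesis by (simp add: cardX)
  qed
  have add: "(\<lambda>z. c z + d z) \<in> code p m u" if cd: "c \<in> code p m u" "d \<in> code p m u"
    for c d :: "'a \<times> 'a \<Rightarrow> 'a"
  proof -
    obtain w w' where "c = word w" "d = word w'" using cd unfolding code_eq by blast
    then have "(\<lambda>z. c z + d z) = word (w + w')" by (auto simp: word_eq B_add_right)
    then show ?thesis by (simp add: code_eq)
  qed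
  have vals: "c z \<in> {of_nat k | k. k < p}" if "c \<in> code p m u" for c and z :: "'a \<times> 'a"
    using that unfolding P_eq[symmetric] by (auto simp: code_eq word_eq B_def Tr_in_P)
  have card_code: "card (code p m u :: ('a \<times> 'a \<Rightarrow> 'a) set) = p ^ (2 * m)"
    unfolding code_eq using inj by (simp add: card_image card_V mult_2 power_add)
  \<comment> \<open>Ensures that both candidate weights really occur.\<close>
  have "A1 > 0" "A2 > 0"
    unfolding A1_def A2_def q s_def[symmetric] using s1 r ts by (cases special; simp add: t)+
  then have "{w. W w = w1} \<noteq> {}" "{w. W w = w2} \<noteq> {}"
    unfolding W_eq using cardX cardnX by (metis card.empty less_irrefl_nat)+
  then obtain z1 z2 where z12: "W z1 = w1" "W z2 = w2" by auto
  have "{hweight (D2 p m u) c | c. c \<in> (code p m u :: ('a \<times> 'a \<Rightarrow> 'a) set) \<and> c \<noteq> (\<lambda>_. 0)} = W ` (UNIV - {0})"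
  proof -
    have "word w \<noteq> (\<lambda>_. 0) \<longleftrightarrow> w \<noteq> 0" for w
      using inj_eq[OF inj, of w 0] by (simp add: word_0)
    then show ?thesis by (auto simp: code_eq W_def)
  qed
  also have "\<dots> = {w1, w2}"
  proof
    show "W ` (UNIV - {0}) \<subseteq> {w1, w2}" by (auto simp: W)
    have "z1 \<noteq> 0" "z2 \<noteq> 0" using z12 W[of 0] w1_pos w2_pos by auto
    then show "{w1, w2} \<subseteq> W ` (UNIV - {0})" using z12 by auto
  qed
  finally have weights: "{hweight (D2 p m u) c | c. c \<in> (code p m u :: ('a \<times> 'a \<Rightarrow> 'a) set) \<and>
    c \<noteq> (\<lambda>_. 0)} = {w1, w2}" .
  show ?thesis
    unfolding Let_def special_def[symmetric] w1_def[symmetric] w2_def[symmetric] A1_def[symmetric]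
      A2_def[symmetric]
    using D2 add vals card_code weights w12 by (simp add: wmult W_eq cardX cardnX)
qed

end
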